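(* Let $K$ be a dyadic non-Archimedean local field of characteristic zero and $E/K$ a ramified quadratic field extension whose residue field is not $\mathbb{F}_2$. Then for every (non-degenerate) hermitian lattice $L$ over $E$ we have $X(L)=S(L)$.
   Context: Dyadic means $2$ is not a unit in the valuation ring $\mathfrak{o}$ of $K$. $E$ has non-trivial $K$-automorphism $x\mapsto\bar x$, trace $\mathrm{Tr}(\alpha)=\alpha+\bar\alpha$; $\mathcal{O}$ is the ring of integers of $E$. A hermitian space is a finitely generated free $E$-module $V$ with $\langle\cdot,\cdot\rangle:V\times V\to E$, $E$-linear in the first argument, $\langle x,y\rangle=\overline{\langle y,x\rangle}$. A hermitian lattice is a finitely generated $\mathcal{O}$-submodule $L$ of such $V$, non-degenerate if no nonzero element of $L$ is orthogonal to all of $L$. $U(L)=\{f\in U(V):f(L)=L\}$ where $U(V)$ is the group of form-preserving $E$-linear automorphisms. For $s\in V$, $\sigma\in E^\times$ with $\langle s,s\rangle=\mathrm{Tr}(\sigma)$, the symmetry is $S_{s,\sigma}(x)=x-\langle x,s\rangle\sigma^{-1}s$; $S(L)$ is the subgroup of $U(L)$ generated by symmetries lying in $U(L)$. A hyperbolic pair splitting $L$ is a pair $(u,v)$ of linearly independent isotropic elements of $L$ such that, with $P=\mathcal{O}u\oplus\mathcal{O}v$, $L=P\perp P^\perp$ ($P^\perp$ the orthogonal complement of $P$ in $L$). For such a pair, $y\in P^\perp$ with $\langle L,y\rangle\subseteq\langle u,v\rangle\mathcal{O}$ and $\mu\in\mathcal{O}$ with $\mathrm{Tr}(\mu\langle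 u,v\rangle)=-\langle y,y\rangle$, the rescaled Eichler isometry $E^\mu_y\in U(L)$ is $x\mapsto x+\frac{\langle x,u\rangle}{\langle v,u\rangle}y+\Big(\frac{\mu\langle x,u\rangle}{\langle v,u\rangle}-\frac{\langle x,y\rangle}{\langle u,v\rangle}\Big)u$. $X(L)$ is the subgroup of $U(L)$ generated by $S(L)$ and all rescaled Eichler isometries of $L$. *)

theory Defs
  imports
    Complex_Main
    "HOL-Computational_Algebra.Polynomial"
    "HOL-Algebra.QuotRing"
    "HOL-Algebra.Ideal_Product"
    "HOL-Algebra.Generated_Groups"
begin

section \<open>Valuation rings, local fields and ramification\<close>

definition ring_on :: "'a::comm_ring_1 set \<Rightarrow> 'a ring" where
  "ring_on R = \<lparr>carrier = R, monoid.mult = (*), one = 1, zero = 0, add = (+)\<rparr>"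

text \<open>The maximal ideal of a local ring consists of its non-units.
  The definition is only meaningful for local rings.\<close>

definition max_ideal :: "'a::comm_ring_1 set \<Rightarrow> 'a set" where
  "max_ideal R = R - Units (ring_on R)"

definition residue_field :: "'a::comm_ring_1 set \<Rightarrow> 'a set ring" where
  "residue_field R = ring_on R Quot max_ideal R"

text \<open>Valuations are additive with values in the integers. The convention that the
  valuation of zero is infinite is implemented by never inspecting the value at zero.\<close>

definition val_ge :: "('k::field \<Rightarrow> int) \<Rightarrow> int \<Rightarrow> 'k \<Rightarrow> bool" where
  "val_ge v N x \<longleftrightarrow> x = 0 \<or> N \<le> v x"

definition valuation_ring :: "('k::field \<Rightarrow> int) \<Rightarrow> 'k set" where
  "valuation_ring v = {x. val_ge v 0 x}"

locale nonarch_local_field =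
  fixes v :: "'k::field \<Rightarrow> int"
  assumes val_mult: "x \<noteq> 0 \<Longrightarrow> y \<noteq> 0 \<Longrightarrow> v (x * y) = v x + v y"
    and val_add: "x \<noteq> 0 \<Longrightarrow> y \<noteq> 0 \<Longrightarrow> x + y \<noteq> 0 \<Longrightarrow> min (v x) (v y) \<le> v (x + y)"
    and val_normalized: "\<exists>p. p \<noteq> 0 \<and> v p = 1"
    and complete: "(\<And>N. \<exists>n0. \<forall>m\<ge>n0. \<forall>n\<ge>n0. val_ge v N (X m - X n)) \<Longrightarrow>
          \<exists>l. \<forall>N. \<exists>n0. \<forall>n\<ge>n0. val_ge v N ((X :: nat \<Rightarrow> 'k) n - l)"
    and finite_residue_field: "finite (carrier (residue_field (valuation_ring v)))"

definition dyadic :: "('k::field \<Rightarrow> int) \<Rightarrow> bool" where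
  "dyadic v \<longleftrightarrow> 2 \<notin> Units (ring_on (valuation_ring v))"

text \<open>A quadratic extension of fields is given by the embedding \<open>\<iota>\<close> of the base field and
  comes with its non-trivial automorphism over the base field.\<close>

locale quadratic_extension =
  fixes \<iota> :: "'k::field \<Rightarrow> 'e::field"
    and bar :: "'e \<Rightarrow> 'e"
  assumes emb_one: "\<iota> 1 = 1"
    and emb_add: "\<iota> (a + b) = \<iota> a + \<iota> b"
    and emb_mult: "\<iota> (a * b) = \<iota> a * \<iota> b"
    and degree_two: "vector_space.dim (\<lambda>a x. \<iota> a * x) (UNIV :: 'e set) = 2"
    and bar_bij: "bij bar"
    and bar_add: "bar (x + y) = bar x + bar y"
    and bar_mult: "bar (x * y) = bar x * bar y"
    and bar_emb: "bar (\<iota> a) = \<iota> a"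
    and bar_nontrivial: "bar \<noteq> id"

definition integral_closure :: "('k::field \<Rightarrow> 'e::field) \<Rightarrow> 'k set \<Rightarrow> 'e set" where
  "integral_closure \<iota> R =
     {x. \<exists>p. lead_coeff p = 1 \<and> (\<forall>i. coeff p i \<in> R) \<and> poly (map_poly \<iota> p) x = 0}"

definition ring_of_integers :: "('k::field \<Rightarrow> int) \<Rightarrow> ('k \<Rightarrow> 'e::field) \<Rightarrow> 'e set" where
  "ring_of_integers v \<iota> = integral_closure \<iota> (valuation_ring v)"

text \<open>The ideal of the upper ring generated by the maximal ideal of the lower ring is the
  \<open>e\<close>-th power of the upper maximal ideal for a ramification index \<open>e\<close> greater than one.\<close>

definition ramified :: "('k::field \<Rightarrow> int) \<Rightarrow> ('k \<Rightarrow> 'e::field) \<Rightarrow> bool" where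
  "ramified v \<iota> \<longleftrightarrow>
     (let \<O> = ring_of_integers v \<iota> in
       \<exists>e::nat. e > 1 \<and>
         genideal (ring_on \<O>) (\<iota> ` max_ideal (valuation_ring v)) =
         max_ideal \<O> [^]\<^bsub>ideals_set (ring_on \<O>)\<^esub> e)"

section \<open>Hermitian spaces and lattices\<close>

definition trace :: "('e::field \<Rightarrow> 'e) \<Rightarrow> 'e \<Rightarrow> 'e" where
  "trace bar a = a + bar a"

text \<open>The space may be degenerate.\<close>

locale hermitian_space = vector_space scale
  for scale :: "'e::field \<Rightarrow> 'v::ab_group_add \<Rightarrow> 'v" +
  fixes bar :: "'e \<Rightarrow> 'e"
    and h :: "'v \<Rightarrow> 'v \<Rightarrow> 'e"
  assumes finitely_generated: "\<exists>B. finite B \<and> span B = UNIV"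
    and form_linear: "Vector_Spaces.linear scale (*) (\<lambda>x. h x y)"
    and form_hermitian: "h x y = bar (h y x)"

definition unitary_group ::
  "('e::field \<Rightarrow> 'v::ab_group_add \<Rightarrow> 'v) \<Rightarrow> ('v \<Rightarrow> 'v \<Rightarrow> 'e) \<Rightarrow> ('v \<Rightarrow> 'v) monoid" where
  "unitary_group scale h =
     \<lparr>carrier = {f. Vector_Spaces.linear scale scale f \<and> bij f \<and> (\<forall>x y. h (f x) (f y) = h x y)},
      monoid.mult = (\<circ>), one = id\<rparr>"

definition lattice_span ::
  "'e::field set \<Rightarrow> ('e \<Rightarrow> 'v::ab_group_add \<Rightarrow> 'v) \<Rightarrow> 'v set \<Rightarrow> 'v set" where
  "lattice_span \<O> scale B = {\<Sum>b\<in>B. scale (c b) b | c. \<forall>b\<in>B. c b \<in> \<O>}"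

text \<open>A lattice need not span the ambient space.\<close>

definition hermitian_lattice ::
  "'e::field set \<Rightarrow> ('e \<Rightarrow> 'v::ab_group_add \<Rightarrow> 'v) \<Rightarrow> 'v set \<Rightarrow> bool" where
  "hermitian_lattice \<O> scale L \<longleftrightarrow> (\<exists>B. finite B \<and> L = lattice_span \<O> scale B)"

definition nondegenerate :: "('v::ab_group_add \<Rightarrow> 'v \<Rightarrow> 'e::field) \<Rightarrow> 'v set \<Rightarrow> bool" where
  "nondegenerate h L \<longleftrightarrow> (\<forall>x\<in>L. (\<forall>y\<in>L. h x y = 0) \<longrightarrow> x = 0)"

definition lattice_isometries ::
  "('e::field \<Rightarrow> 'v::ab_group_add \<Rightarrow> 'v) \<Rightarrow> ('v \<Rightarrow> 'v \<Rightarrow> 'e) \<Rightarrow> 'v set \<Rightarrow> ('v \<Rightarrow> 'v) set" where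
  "lattice_isometries scale h L = {f \<in> carrier (unitary_group scale h). f ` L = L}"

definition lattice_unitary_group ::
  "('e::field \<Rightarrow> 'v::ab_group_add \<Rightarrow> 'v) \<Rightarrow> ('v \<Rightarrow> 'v \<Rightarrow> 'e) \<Rightarrow> 'v set \<Rightarrow> ('v \<Rightarrow> 'v) monoid" where
  "lattice_unitary_group scale h L =
     (unitary_group scale h)\<lparr>carrier := lattice_isometries scale h L\<rparr>"

section \<open>Symmetries and rescaled Eichler isometries\<close>

definition symmetry ::
  "('e::field \<Rightarrow> 'v::ab_group_add \<Rightarrow> 'v) \<Rightarrow> ('v \<Rightarrow> 'v \<Rightarrow> 'e) \<Rightarrow> 'v \<Rightarrow> 'e \<Rightarrow> 'v \<Rightarrow> 'v" where
  "symmetry scale h s \<sigma> x = x - scale (h x s * inverse \<sigma>) s"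

definition symmetries ::
  "('e::field \<Rightarrow> 'v::ab_group_add \<Rightarrow> 'v) \<Rightarrow> ('e \<Rightarrow> 'e) \<Rightarrow> ('v \<Rightarrow> 'v \<Rightarrow> 'e) \<Rightarrow> ('v \<Rightarrow> 'v) set" where
  "symmetries scale bar h = {symmetry scale h s \<sigma> | s \<sigma>. \<sigma> \<noteq> 0 \<and> h s s = trace bar \<sigma>}"

definition symmetry_subgroup ::
  "('e::field \<Rightarrow> 'v::ab_group_add \<Rightarrow> 'v) \<Rightarrow> ('e \<Rightarrow> 'e) \<Rightarrow> ('v \<Rightarrow> 'v \<Rightarrow> 'e) \<Rightarrow> 'v set
     \<Rightarrow> ('v \<Rightarrow> 'v) set" where
  "symmetry_subgroup scale bar h L =
     generate (lattice_unitary_group scale h L)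
       (symmetries scale bar h \<inter> lattice_isometries scale h L)"

definition orthogonal_complement ::
  "('v::ab_group_add \<Rightarrow> 'v \<Rightarrow> 'e::field) \<Rightarrow> 'v set \<Rightarrow> 'v set \<Rightarrow> 'v set" where
  "orthogonal_complement h L P = {x\<in>L. \<forall>p\<in>P. h x p = 0}"

definition hyperbolic_pair_splits ::
  "'e::field set \<Rightarrow> ('e \<Rightarrow> 'v::ab_group_add \<Rightarrow> 'v) \<Rightarrow> ('v \<Rightarrow> 'v \<Rightarrow> 'e) \<Rightarrow> 'v set
     \<Rightarrow> 'v \<Rightarrow> 'v \<Rightarrow> bool" where
  "hyperbolic_pair_splits \<O> scale h L u w \<longleftrightarrow>
     (let P = lattice_span \<O> scale {u, w}; Q = orthogonal_complement h L P in
       u \<in> L \<and> w \<in> L \<and> u \<noteq> w \<and> \<not> module.dependent scale {u, w} \<and> h u u = 0 \<and> h w w = 0 \<and>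
       P \<inter> Q = {0} \<and> L = {p + q | p q. p \<in> P \<and> q \<in> Q})"

definition eichler ::
  "('e::field \<Rightarrow> 'v::ab_group_add \<Rightarrow> 'v) \<Rightarrow> ('v \<Rightarrow> 'v \<Rightarrow> 'e) \<Rightarrow> 'v \<Rightarrow> 'v \<Rightarrow> 'v \<Rightarrow> 'e \<Rightarrow> 'v \<Rightarrow> 'v" where
  "eichler scale h u w y \<mu> x =
     x + scale (h x u / h w u) y + scale (\<mu> * h x u / h w u - h x y / h u w) u"

definition eichler_isometries ::
  "'e::field set \<Rightarrow> ('e \<Rightarrow> 'v::ab_group_add \<Rightarrow> 'v) \<Rightarrow> ('e \<Rightarrow> 'e) \<Rightarrow> ('v \<Rightarrow> 'v \<Rightarrow> 'e) \<Rightarrow> 'v set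
     \<Rightarrow> ('v \<Rightarrow> 'v) set" where
  "eichler_isometries \<O> scale bar h L =
     {eichler scale h u w y \<mu> | u w y \<mu>.
        hyperbolic_pair_splits \<O> scale h L u w \<and>
        y \<in> orthogonal_complement h L (lattice_span \<O> scale {u, w}) \<and>
        (\<forall>x\<in>L. h x y \<in> {h u w * c | c. c \<in> \<O>}) \<and>
        \<mu> \<in> \<O> \<and> trace bar (\<mu> * h u w) = - h y y}"

definition eichler_symmetry_subgroup ::
  "'e::field set \<Rightarrow> ('e \<Rightarrow> 'v::ab_group_add \<Rightarrow> 'v) \<Rightarrow> ('e \<Rightarrow> 'e) \<Rightarrow> ('v \<Rightarrow> 'v \<Rightarrow> 'e) \<Rightarrow> 'v set
     \<Rightarrow> ('v \<Rightarrow> 'v) set" where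
  "eichler_symmetry_subgroup \<O> scale bar h L =
     generate (lattice_unitary_group scale h L)
       (symmetry_subgroup scale bar h L \<union> eichler_isometries \<O> scale bar h L)"

end

theory Submission
  imports Defs
begin

text \<open>
  Since the residue field has more than two elements, there is a unit \<open>\<epsilon>\<close> such that \<open>\<epsilon> - 1\<close> is a
  unit, too. Let \<open>(u, w)\<close> be a hyperbolic pair splitting \<open>L\<close>, let \<open>a = h u w\<close>, and let \<open>T\<close> be the
  symmetry for \<open>(u + \<epsilon> w, a \<epsilon>\<^sup>*)\<close> followed by the symmetry for \<open>(u + w, a\<^sup>*)\<close>, where the star is the
  involution. Then \<open>T\<close> maps \<open>u\<close> to \<open>\<epsilon> u\<close> and fixes the orthogonal complement of \<open>u\<close> and \<open>w\<close>, so that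
  conjugation by \<open>T\<close> turns the Eichler isometry of \<open>y'\<close> into one of \<open>\<epsilon>\<^sup>* y'\<close>. Hence the commutator
  of the two is an Eichler isometry of \<open>(\<epsilon>\<^sup>* - 1) y'\<close>, and every admissible \<open>y\<close> is of this form.
  The commutator is a product of symmetries, and two Eichler isometries of the same \<open>y\<close> differ by
  one of \<open>0\<close>, which is itself a symmetry (or the identity).

  Integrality of these symmetries uses that \<open>a\<^sup>* / a\<close> is integral, which is where ramification enters:
  it forces the ring of integers to be local, hence to contain all elements of norm one.
\<close>

section \<open>Rings of integers of quadratic extensions\<close>

lemma ring_on_simps:
  "carrier (ring_on S) = S" "monoid.mult (ring_on S) = (*)" "one (ring_on S) = 1"
  "zero (ring_on S) = 0" "add (ring_on S) = (+)"
  by (simp_all add: ring_on_def)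

lemma in_max_ideal_iff:
  fixes S :: "'f::field set"
  shows "x \<in> max_ideal S \<longleftrightarrow> x \<in> S \<and> \<not> (x \<noteq> 0 \<and> 1 / x \<in> S)"
proof -
  have "x \<in> Units (ring_on S) \<longleftrightarrow> x \<in> S \<and> x \<noteq> 0 \<and> 1 / x \<in> S"
  proof
    assume "x \<in> Units (ring_on S)"
    then obtain y where y: "x \<in> S" "y \<in> S" "y * x = 1" by (auto simp: Units_def ring_on_simps)
    then have "x \<noteq> 0" by auto
    with y(3) have "y = 1 / x" by (simp add: eq_divide_eq)
    then show "x \<in> S \<and> x \<noteq> 0 \<and> 1 / x \<in> S" using y \<open>x \<noteq> 0\<close> by simp
  next
    assume x: "x \<in> S \<and> x \<noteq> 0 \<and> 1 / x \<in> S"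
    then have "\<exists>y\<in>S. y * x = 1 \<and> x * y = 1" by (intro bexI[of _ "1 / x"]) simp_all
    with x show "x \<in> Units (ring_on S)" by (simp add: Units_def ring_on_simps)
  qed
  then show ?thesis unfolding max_ideal_def by blast
qed

context nonarch_local_field
begin

lemma val_one: "v 1 = 0"
  using val_mult[of 1 1] by simp

lemma val_uminus: "v (- x) = v x"
proof (cases "x = 0")
  case False
  have "v (- 1) = 0"
    using val_mult[of "- 1" "- 1"] val_one by simp
  then show ?thesis
    using val_mult[of "- 1" x] False by simp
qed simp

lemma val_ge_add: "val_ge v N x \<Longrightarrow> val_ge v N y \<Longrightarrow> val_ge v N (x + y)"
  using val_add[of x y] by (cases "x = 0 \<or> y = 0 \<or> x + y = 0") (auto simp: val_ge_def)

lemma val_ge_uminus: "val_ge v N x \<Longrightarrow> val_ge v N (- x)"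
  by (simp add: val_ge_def val_uminus)

lemma val_ge_mult: "val_ge v M x \<Longrightarrow> val_ge v N y \<Longrightarrow> val_ge v (M + N) (x * y)"
  by (cases "x = 0"; cases "y = 0") (simp_all add: val_ge_def val_mult)

lemma val_ge_mono: "val_ge v N x \<Longrightarrow> M \<le> N \<Longrightarrow> val_ge v M x"
  by (auto simp: val_ge_def)

lemma val_ge_sum: "(\<And>i. i \<in> I \<Longrightarrow> val_ge v N (f i)) \<Longrightarrow> val_ge v N (sum f I)"
  by (induction I rule: infinite_finite_induct) (auto intro: val_ge_add simp: val_ge_def[of v N 0])

lemma valuation_ring_iff: "x \<in> valuation_ring v \<longleftrightarrow> val_ge v 0 x"
  by (simp add: valuation_ring_def)

lemma valuation_ring_simps:
  "0 \<in> valuation_ring v" "1 \<in> valuation_ring v"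
  "x \<in> valuation_ring v \<Longrightarrow> y \<in> valuation_ring v \<Longrightarrow> x + y \<in> valuation_ring v"
  "x \<in> valuation_ring v \<Longrightarrow> - x \<in> valuation_ring v"
  "x \<in> valuation_ring v \<Longrightarrow> y \<in> valuation_ring v \<Longrightarrow> x * y \<in> valuation_ring v"
  using val_ge_mult[of 0 x 0 y]
  by (auto simp: valuation_ring_iff val_ge_add val_ge_uminus) (auto simp: val_ge_def val_one)

lemma valuation_ring_diff:
  "x \<in> valuation_ring v \<Longrightarrow> y \<in> valuation_ring v \<Longrightarrow> x - y \<in> valuation_ring v"
  using valuation_ring_simps(3)[of x "- y"] valuation_ring_simps(4)[of y] by simp

text \<open>In a product of two polynomials, the coefficient at the sum of two such indices has
  exactly one term of least valuation. The minimum exists because only finitely many coefficients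
  are nonzero.\<close>

lemma first_minimal_coeff:
  fixes f :: "'k poly"
  assumes "f \<noteq> 0"
  obtains i where "coeff f i \<noteq> 0" "\<And>j. val_ge v (v (coeff f i)) (coeff f j)"
    "\<And>j. j < i \<Longrightarrow> val_ge v (v (coeff f i) + 1) (coeff f j)"
proof -
  define V where "V = (\<lambda>j. v (coeff f j)) ` {j. j \<le> degree f \<and> coeff f j \<noteq> 0}"
  have V: "finite V" "V \<noteq> {}"
    using assms by (auto simp: V_def intro!: exI[of _ "degree f"])
  define P where "P j \<longleftrightarrow> coeff f j \<noteq> 0 \<and> v (coeff f j) = Min V" for j
  have "\<exists>j. P j" using Min_in[OF V] by (auto simp: V_def P_def)
  define i where "i = (LEAST j. P j)"
  have P: "P i" unfolding i_def using \<open>\<exists>j. P j\<close> by (rule LeastI_ex)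
  have min: "Min V \<le> v (coeff f j)" if "coeff f j \<noteq> 0" for j
    using V that le_degree[of f j] by (intro Min_le) (auto simp: V_def)
  have "val_ge v (v (coeff f i) + 1) (coeff f j)" if "j < i" for j
    using min[of j] not_less_Least[of j P] that P
    by (cases "coeff f j = 0") (auto simp: i_def P_def val_ge_def)
  moreover have "val_ge v (v (coeff f i)) (coeff f j)" for j
    using min[of j] P by (auto simp: P_def val_ge_def)
  ultimately show ?thesis
    using P that[of i] by (simp add: P_def)
qed

text \<open>Gauss's lemma: the product of the first coefficients of minimal valuation dominates the
  coefficient of \<open>f * g\<close> to which it contributes.\<close>

lemma monic_factor_integral:
  fixes f g :: "'k poly"
  assumes f: "lead_coeff f = 1" and g: "lead_coeff g = 1"
    and fg: "\<And>i. coeff (f * g) i \<in> valuation_ring v"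
  shows "coeff f i \<in> valuation_ring v"
proof -
  have "f \<noteq> 0" "g \<noteq> 0" using f g by auto
  obtain m where m: "coeff f m \<noteq> 0" "\<And>j. val_ge v (v (coeff f m)) (coeff f j)"
    "\<And>j. j < m \<Longrightarrow> val_ge v (v (coeff f m) + 1) (coeff f j)"
    using first_minimal_coeff[OF \<open>f \<noteq> 0\<close>] by blast
  obtain n where n: "coeff g n \<noteq> 0" "\<And>j. val_ge v (v (coeff g n)) (coeff g j)"
    "\<And>j. j < n \<Longrightarrow> val_ge v (v (coeff g n) + 1) (coeff g j)"
    using first_minimal_coeff[OF \<open>g \<noteq> 0\<close>] by blast
  define A B where "A = v (coeff f m)" and "B = v (coeff g n)"
  have "A + B \<ge> 0"
  proof (rule ccontr)
    assume neg: "\<not> A + B \<ge> 0"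
    \<comment> \<open>For k < m the factor from f is strictly above its minimum; for k > m the index
      m + n - k is below n, so the factor from g is. Only k = m attains A + B.\<close>
    have other: "val_ge v (A + B + 1) (coeff f k * coeff g (m + n - k))"
      if "k \<in> {..m + n} - {m}" for k
    proof (cases "k < m")
      case True
      then show ?thesis using val_ge_mult[OF m(3)[OF True] n(2)[of "m + n - k"]] by (simp add: A_def B_def add_ac)
    next
      case False
      with that have *: "m + n - k < n" by auto
      show ?thesis using val_ge_mult[OF m(2)[of k] n(3)[OF *]] by (simp add: A_def B_def add_ac)
    qed
    have "coeff (f * g) (m + n) =
        coeff f m * coeff g n + (\<Sum>k\<in>{..m + n} - {m}. coeff f k * coeff g (m + n - k))"
      unfolding coeff_mult by (subst sum.remove[of _ m]) simp_all
    then have eq: "coeff f m * coeff g n = coeff (f * g) (m + n) +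
        - (\<Sum>k\<in>{..m + n} - {m}. coeff f k * coeff g (m + n - k))"
      by simp
    have "val_ge v (A + B + 1) (coeff (f * g) (m + n))"
      using fg[of "m + n"] neg by (intro val_ge_mono[of 0 _ "A + B + 1"]) (simp_all add: valuation_ring_iff)
    then have "val_ge v (A + B + 1) (coeff f m * coeff g n)"
      unfolding eq using other by (intro val_ge_add val_ge_uminus val_ge_sum)
    then show False
      using m(1) n(1) by (simp add: val_ge_def val_mult A_def B_def)
  qed
  \<comment> \<open>The leading coefficient 1 of g has valuation 0, so the minimum B is at most 0
    and A is at least 0.\<close>
  moreover have "B \<le> 0"
    using n(2)[of "degree g"] g by (simp add: val_ge_def val_one B_def)
  ultimately show ?thesis
    unfolding valuation_ring_iff by (intro val_ge_mono[OF m(2)]) (simp add: A_def)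
qed

text \<open>s and t are the roots of a monic quadratic polynomial with integral coefficients, so
  Gauss's lemma applies to its factor X - s.\<close>

lemma valuation_ring_if_sum_prod:
  assumes "s + t \<in> valuation_ring v" "s * t \<in> valuation_ring v"
  shows "s \<in> valuation_ring v"
proof -
  have "[:- s, 1:] * [:- t, 1:] = [:s * t, - (s + t), 1:]" by simp
  moreover have "coeff [:s * t, - (s + t), 1:] i \<in> valuation_ring v" for i
    using assms valuation_ring_simps(1,2) valuation_ring_simps(4)[OF assms(1)]
    by (simp add: coeff_pCons split: nat.split)
  ultimately have "coeff ([:- s, 1:] * [:- t, 1:]) i \<in> valuation_ring v" for i
    by (simp only:)
  then have "coeff [:- s, 1:] 0 \<in> valuation_ring v"
    by (intro monic_factor_integral[of "[:- s, 1:]" "[:- t, 1:]"]) simp_all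
  then show ?thesis using valuation_ring_simps(4)[of "- s"] by simp
qed

end

section \<open>Quadratic extensions: conjugation, trace and norm\<close>

context quadratic_extension
begin

lemma emb_0: "\<iota> 0 = 0"
  using emb_add[of 0 0] by (metis add_cancel_right_left)

lemma emb_minus: "\<iota> (- a) = - \<iota> a"
  using emb_add[of a "- a"] by (simp add: emb_0 eq_neg_iff_add_eq_0 add.commute)

lemma emb_diff: "\<iota> (a - b) = \<iota> a - \<iota> b"
  using emb_add[of a "- b"] by (simp add: emb_minus)

lemma emb_eq_0_iff: "\<iota> a = 0 \<longleftrightarrow> a = 0"
proof
  show "a = 0" if "\<iota> a = 0"
  proof (rule ccontr)
    assume "a \<noteq> 0"
    then show False using emb_mult[of a "1 / a"] that by (simp add: emb_one)
  qed
qed (simp add: emb_0)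

lemma emb_eq_iff: "\<iota> a = \<iota> b \<longleftrightarrow> a = b"
  using emb_eq_0_iff[of "a - b"] by (simp add: emb_diff)

lemma emb_divide: "\<iota> (a / b) = \<iota> a / \<iota> b"
proof (cases "b = 0")
  case False
  then show ?thesis
    using emb_mult[of "a / b" b] by (simp add: eq_divide_eq emb_eq_0_iff)
qed (simp add: emb_0)

lemma emb_2: "\<iota> 2 = 2"
  using emb_add[of 1 1] by (simp add: emb_one)

lemmas emb_simps = emb_2 emb_0 emb_one emb_add emb_minus emb_diff emb_mult emb_divide

lemma bar_0: "bar 0 = 0"
  using bar_emb[of 0] by (simp add: emb_0)

lemma bar_1: "bar 1 = 1"
  using bar_emb[of 1] by (simp add: emb_one)

lemma bar_eq_iff: "bar x = bar y \<longleftrightarrow> x = y"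
  using bar_bij by (auto simp: bij_def inj_def)

lemma bar_minus: "bar (- x) = - bar x"
  using bar_add[of x "- x"] by (simp add: bar_0 eq_neg_iff_add_eq_0 add.commute)

lemma bar_divide: "bar (x / y) = bar x / bar y"
proof (cases "y = 0")
  case False
  then have "bar y \<noteq> 0" using bar_eq_iff[of y 0] by (simp add: bar_0)
  with False show ?thesis
    using bar_mult[of "x / y" y] by (simp add: eq_divide_eq)
qed (simp add: bar_0)

text \<open>Any element moved by \<open>bar\<close> lies outside the image of
  \<open>\<iota>\<close>, hence is independent of 1; in dimension two this already gives a spanning
  set.\<close>

lemma primitive_element:
  obtains \<theta> where "bar \<theta> \<noteq> \<theta>" "\<And>x. \<exists>a b. x = \<iota> a + \<iota> b * \<theta>"
proof -
  interpret V: vector_space "\<lambda>a x. \<iota> a * x"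
    by unfold_locales (simp_all add: emb_simps algebra_simps)
  obtain \<theta> where \<theta>: "bar \<theta> \<noteq> \<theta>" using bar_nontrivial by (auto simp: fun_eq_iff)
  obtain B where B: "V.independent B" "UNIV \<subseteq> V.span B" "card B = 2"
    using V.basis_exists[of UNIV] degree_two by metis
  have finB: "finite B" using B(3) by (simp add: card_ge_0_finite)
  have span1: "V.span {1} = range \<iota>" by (auto simp: V.span_singleton)
  have "\<theta> \<notin> range \<iota>" using \<theta> bar_emb by auto
  then have "V.independent {\<theta>, 1}"
    by (simp add: V.independent_insert span1)
  have span: "x \<in> V.span {\<theta>, 1}" for x
  proof (rule ccontr)
    assume x: "x \<notin> V.span {\<theta>, 1}"
    then have "V.independent {x, \<theta>, 1}"
      using \<open>V.independent {\<theta>, 1}\<close> by (simp add: V.independent_insert)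
    moreover have "{x, \<theta>, 1} \<subseteq> V.span B" using B(2) by (rule subset_trans[OF subset_UNIV])
    ultimately have "card {x, \<theta>, 1} \<le> 2"
      using V.independent_span_bound[OF finB] B(3) by metis
    moreover have "x \<noteq> \<theta>" "x \<noteq> 1" using x by (auto intro: V.span_base)
    moreover have "\<theta> \<noteq> 1" using \<theta> bar_1 by auto
    ultimately show False by simp
  qed
  have "\<exists>a b. x = \<iota> a + \<iota> b * \<theta>" for x
  proof -
    have "x \<in> V.span (insert \<theta> {1})" by (rule span)
    then obtain b where "x - \<iota> b * \<theta> \<in> range \<iota>"
      unfolding V.span_breakdown_eq span1 by blast
    then obtain a where "x - \<iota> b * \<theta> = \<iota> a" by blast
    then have "x = \<iota> a + \<iota> b * \<theta>" by (simp add: algebra_simps)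
    then show ?thesis by blast
  qed
  then show ?thesis using that \<theta> by blast
qed

text \<open>The locale asks only for a nontrivial automorphism. That it is an involution follows
  because \<open>bar \<theta>\<close> is the second root of the quadratic polynomial of \<theta>,
  which also gives trace and norm of \<theta>; general elements follow by expanding in 1 and
  \<theta>.\<close>

lemma bar_bar: "bar (bar x) = x"
  and trace_in_base: "\<exists>t. x + bar x = \<iota> t"
  and norm_in_base: "\<exists>n. x * bar x = \<iota> n"
proof -
  obtain \<theta> where \<theta>: "bar \<theta> \<noteq> \<theta>" "\<And>x. \<exists>a b. x = \<iota> a + \<iota> b * \<theta>"
    using primitive_element by blast
  obtain c d where cd: "\<theta> * \<theta> = \<iota> c + \<iota> d * \<theta>" using \<theta>(2) by blast
  have "bar \<theta> * bar \<theta> = \<iota> c + \<iota> d * bar \<theta>"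
    using arg_cong[OF cd, of bar] by (simp add: bar_add bar_mult bar_emb)
  \<comment> \<open>Subtracting the two quadratic relations leaves a factor
    \<open>\<theta> - bar \<theta>\<close>, which is nonzero and cancels.\<close>
  with cd have "(\<theta> - bar \<theta>) * (\<theta> + bar \<theta>) = (\<theta> - bar \<theta>) * \<iota> d"
    by (simp add: algebra_simps)
  then have tr: "\<theta> + bar \<theta> = \<iota> d" using \<theta>(1) by simp
  then have b: "bar \<theta> = \<iota> d - \<theta>" by (simp add: algebra_simps)
  have no: "\<theta> * bar \<theta> = - \<iota> c" unfolding b using cd by (simp add: algebra_simps)
  have "bar \<theta> + bar (bar \<theta>) = \<iota> d"
    using arg_cong[OF tr, of bar] by (simp add: bar_add bar_emb)
  also have "\<dots> = bar \<theta> + \<theta>" using tr by (simp add: add.commute)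
  finally have bb: "bar (bar \<theta>) = \<theta>" by simp
  obtain a b where x: "x = \<iota> a + \<iota> b * \<theta>" using \<theta>(2) by blast
  have bx: "bar x = \<iota> a + \<iota> b * bar \<theta>" by (simp add: x bar_add bar_mult bar_emb)
  show "bar (bar x) = x" unfolding bx by (simp add: x bb bar_add bar_mult bar_emb)
  have "x + bar x = \<iota> a + \<iota> a + \<iota> b * (\<theta> + bar \<theta>)" unfolding bx by (simp add: x algebra_simps)
  then show "\<exists>t. x + bar x = \<iota> t"
    unfolding tr by (metis emb_add emb_mult)
  have "x * bar x = \<iota> a * \<iota> a + \<iota> a * \<iota> b * (\<theta> + bar \<theta>) + \<iota> b * \<iota> b * (\<theta> * bar \<theta>)"
    unfolding bx by (simp add: x algebra_simps)
  then show "\<exists>n. x * bar x = \<iota> n"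
    unfolding tr no by (metis emb_add emb_mult emb_minus)
qed

abbreviation eval_emb :: "'k poly \<Rightarrow> 'e \<Rightarrow> 'e" where
  "eval_emb p x \<equiv> poly (map_poly \<iota> p) x"

lemma eval_emb_pCons: "eval_emb (pCons a p) x = \<iota> a + x * eval_emb p x"
  by (simp add: map_poly_pCons emb_0)

lemma eval_emb_add: "eval_emb (p + q) x = eval_emb p x + eval_emb q x"
  by (induction p q rule: poly_induct2) (simp_all add: eval_emb_pCons emb_add algebra_simps)

lemma eval_emb_smult: "eval_emb (smult a p) x = \<iota> a * eval_emb p x"
  by (simp add: map_poly_smult emb_0 emb_mult)

lemma eval_emb_mult: "eval_emb (p * q) x = eval_emb p x * eval_emb q x"
  by (induction p)
    (simp_all add: mult_pCons_left eval_emb_add eval_emb_smult eval_emb_pCons emb_0 algebra_simps)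

end

section \<open>The integral elements as a ring stable under conjugation\<close>

locale local_quadratic_extension = nonarch_local_field v + quadratic_extension \<iota> bar
  for v :: "'k::field \<Rightarrow> int" and \<iota> :: "'k \<Rightarrow> 'e::field" and bar
begin

abbreviation "\<O> \<equiv> ring_of_integers v \<iota>"

abbreviation "R \<equiv> valuation_ring v"

text \<open>A valuation ring is integrally closed: a root a of a monic integral polynomial splits
  off the monic factor X - a, which is integral by Gauss's lemma.\<close>

lemma integral_emb_iff: "\<iota> a \<in> \<O> \<longleftrightarrow> a \<in> R"
proof
  assume "\<iota> a \<in> \<O>"
  then obtain p where p: "lead_coeff p = 1" "\<And>i. coeff p i \<in> R" "eval_emb p (\<iota> a) = 0"
    by (auto simp: ring_of_integers_def integral_closure_def)
  have "eval_emb p (\<iota> a) = \<iota> (poly p a)"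
    by (induction p) (simp_all add: eval_emb_pCons emb_simps)
  then have "poly p a = 0" using p(3) by (simp add: emb_eq_0_iff)
  then have "[:- a, 1:] dvd p" by (simp add: poly_eq_0_iff_dvd)
  then obtain q where q: "p = [:- a, 1:] * q" by (rule dvdE)
  have "lead_coeff q = 1" using p(1) unfolding q lead_coeff_mult by simp
  then have "coeff [:- a, 1:] 0 \<in> R"
    using p(2)[unfolded q] by (intro monic_factor_integral[of "[:- a, 1:]" q]) simp_all
  then show "a \<in> R" using valuation_ring_simps(4)[of "- a"] by simp
next
  assume "a \<in> R"
  then have "coeff [:- a, 1:] i \<in> R" for i
    using valuation_ring_simps by (auto simp: coeff_pCons split: nat.split)
  moreover have "eval_emb [:- a, 1:] (\<iota> a) = 0" by (simp add: eval_emb_pCons emb_simps)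
  ultimately show "\<iota> a \<in> \<O>"
    unfolding ring_of_integers_def integral_closure_def by (auto intro!: exI[of _ "[:- a, 1:]"])
qed

lemma integralI:
  assumes "x + bar x = \<iota> t" "x * bar x = \<iota> n" "t \<in> R" "n \<in> R"
  shows "x \<in> \<O>"
proof -
  have "eval_emb [:n, - t, 1:] x = x * bar x + x * (- (x + bar x) + x)"
    unfolding assms(1,2) by (simp add: eval_emb_pCons emb_simps)
  then have "eval_emb [:n, - t, 1:] x = 0" by (simp add: algebra_simps)
  moreover have "coeff [:n, - t, 1:] i \<in> R" for i
    using assms valuation_ring_simps by (auto simp: coeff_pCons split: nat.split)
  ultimately show ?thesis
    unfolding ring_of_integers_def integral_closure_def
    by (auto intro!: exI[of _ "[:n, - t, 1:]"])
qed

text \<open>Outside the base field, X^2 - t X + n is the minimal polynomial of x and divides every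
  monic integral polynomial killing x, so Gauss's lemma applies. In the base field, trace and norm
  are 2 a and a^2.\<close>

lemma integral_trace_norm:
  assumes "x \<in> \<O>" "x + bar x = \<iota> t" "x * bar x = \<iota> n"
  shows "t \<in> R" and "n \<in> R"
proof -
  have "t \<in> R \<and> n \<in> R"
  proof (cases "x \<in> range \<iota>")
    case True
    then obtain a where a: "x = \<iota> a" by auto
    then have "a \<in> R" using assms(1) integral_emb_iff by simp
    moreover have "t = a + a" "n = a * a"
      using assms(2,3) by (simp_all add: a bar_emb emb_eq_iff flip: emb_add emb_mult)
    ultimately show ?thesis using valuation_ring_simps(3,5)[of a a] by simp
  next
    case False
    obtain p where p: "lead_coeff p = 1" "\<And>i. coeff p i \<in> R" "eval_emb p x = 0"
      using assms(1) by (auto simp: ring_of_integers_def integral_closure_def)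
    define q where "q = [:n, - t, 1:]"
    have q: "q \<noteq> 0" "degree q = 2" "lead_coeff q = 1" by (simp_all add: q_def)
    have "eval_emb q x = x * bar x + x * (- (x + bar x) + x)"
      unfolding assms(2,3) q_def by (simp add: eval_emb_pCons emb_simps)
    then have "eval_emb q x = 0" by (simp add: algebra_simps)
    define r where "r = p mod q"
    have pq: "p = q * (p div q) + r" by (simp add: r_def)
    then have "eval_emb r x = 0"
      using p(3) \<open>eval_emb q x = 0\<close> eval_emb_add eval_emb_mult by (metis add_0 mult_zero_left)
    have "degree r < 2 \<or> r = 0" unfolding r_def using degree_mod_less[OF q(1), of p] q(2) by auto
    then have r: "r = [:coeff r 0, coeff r 1:]"
      by (intro poly_eqI) (auto simp: coeff_pCons split: nat.split intro: coeff_eq_0)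
    then have eq: "\<iota> (coeff r 0) + x * \<iota> (coeff r 1) = 0"
      using \<open>eval_emb r x = 0\<close> eval_emb_pCons
      by (metis add.right_neutral map_poly_0 mult_zero_right poly_0)
    \<comment> \<open>The remainder is a linear relation for x over the base field; a nonzero slope
      would put x into that field.\<close>
    have "coeff r 1 = 0"
    proof (rule ccontr)
      assume "coeff r 1 \<noteq> 0"
      then have "x = \<iota> (- coeff r 0 / coeff r 1)"
        using eq by (simp add: emb_simps emb_eq_0_iff field_simps eq_neg_iff_add_eq_0)
      then show False using False by blast
    qed
    moreover from this have "coeff r 0 = 0" using eq by (simp add: emb_0 emb_eq_0_iff)
    ultimately have "r = 0" using r by simp
    then have p_eq: "p = q * (p div q)" using pq by simp
    have "lead_coeff (p div q) = 1"
      using p(1) q(3) lead_coeff_mult[of q "p div q"] p_eq by simp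
    then have "coeff q i \<in> R" for i
      using monic_factor_integral[OF q(3), of "p div q"] p(2) p_eq by simp
    from this[of 0] this[of 1] show ?thesis
      using valuation_ring_simps(4)[of "- t"] by (simp add: q_def)
  qed
  then show "t \<in> R" "n \<in> R" by auto
qed

lemma integral_bar:
  assumes "x \<in> \<O>"
  shows "bar x \<in> \<O>"
proof -
  obtain t n where tn: "x + bar x = \<iota> t" "x * bar x = \<iota> n"
    using trace_in_base norm_in_base by blast
  show ?thesis
    by (rule integralI[of _ t n])
      (use tn integral_trace_norm[OF assms tn] in \<open>simp_all add: bar_bar add.commute mult.commute\<close>)
qed

lemma integral_one: "1 \<in> \<O>"
  using integral_emb_iff[of 1] valuation_ring_simps by (simp add: emb_one)

text \<open>The traces of \<open>x * y\<close> and \<open>x * bar y\<close> have integral sum and product, so both are integral.\<close>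

lemma integral_add_mult:
  assumes "x \<in> \<O>" "y \<in> \<O>"
  shows "x + y \<in> \<O> \<and> x * y \<in> \<O>"
proof -
  obtain t n where x: "x + bar x = \<iota> t" "x * bar x = \<iota> n" "t \<in> R" "n \<in> R"
    using trace_in_base norm_in_base integral_trace_norm[OF assms(1)] by metis
  obtain t' n' where y: "y + bar y = \<iota> t'" "y * bar y = \<iota> n'" "t' \<in> R" "n' \<in> R"
    using trace_in_base norm_in_base integral_trace_norm[OF assms(2)] by metis
  obtain r where r: "x * y + bar x * bar y = \<iota> r"
    using trace_in_base[of "x * y"] by (auto simp: bar_mult)
  obtain s where s: "x * bar y + bar x * y = \<iota> s"
    using trace_in_base[of "x * bar y"] by (auto simp: bar_mult bar_bar)
  have "\<iota> (r + s) = \<iota> (t * t')"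
    by (simp add: emb_simps flip: r s x(1) y(1)) (simp add: algebra_simps)
  then have rs: "r + s = t * t'" by (simp add: emb_eq_iff)
  \<comment> \<open>The product expands to n' times the trace of x^2 plus n times the trace of y^2,
    and the trace of x^2 is t^2 - 2 n.\<close>
  have "\<iota> (r * s) = \<iota> (n' * (t * t - (n + n)) + n * (t' * t' - (n' + n')))"
    by (simp add: emb_simps flip: r s x(1,2) y(1,2)) (simp add: algebra_simps)
  then have rs': "r * s = n' * (t * t - (n + n)) + n * (t' * t' - (n' + n'))"
    by (simp only: emb_eq_iff)
  have "r + s \<in> R" "r * s \<in> R"
    unfolding rs rs' by (intro valuation_ring_simps valuation_ring_diff x y)+
  then have rR: "r \<in> R" and sR: "s \<in> R"
    using valuation_ring_if_sum_prod[of r s] valuation_ring_if_sum_prod[of s r]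
    by (simp_all add: ac_simps)
  have "(x + y) + bar (x + y) = \<iota> (t + t')"
    by (simp add: emb_simps bar_add flip: x(1) y(1))
  moreover have "(x + y) * bar (x + y) = \<iota> (n + n' + s)"
    by (simp add: emb_simps bar_add algebra_simps flip: x(2) y(2) s)
  ultimately have "x + y \<in> \<O>"
    by (rule integralI) (simp_all add: x y sR valuation_ring_simps)
  moreover have "x * y + bar (x * y) = \<iota> r" by (simp add: bar_mult r)
  moreover have "x * y * bar (x * y) = \<iota> (n * n')"
    by (simp add: emb_simps bar_mult flip: x(2) y(2))
  ultimately show ?thesis
    using integralI rR x y by (simp add: valuation_ring_simps)
qed

lemma integral_add: "x \<in> \<O> \<Longrightarrow> y \<in> \<O> \<Longrightarrow> x + y \<in> \<O>"
  and integral_mult: "x \<in> \<O> \<Longrightarrow> y \<in> \<O> \<Longrightarrow> x * y \<in> \<O>"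
  using integral_add_mult by auto

lemma integral_uminus: "x \<in> \<O> \<Longrightarrow> - x \<in> \<O>"
  using integral_mult[of "\<iota> (- 1)" x] integral_emb_iff[of "- 1"] valuation_ring_simps
  by (simp add: emb_simps)

lemma integral_zero: "0 \<in> \<O>"
  using integral_emb_iff[of 0] valuation_ring_simps by (simp add: emb_0)

section \<open>Locality of the ring of integers and its consequences\<close>

lemma ring_ring_of_integers: "ring (ring_on \<O>)"
proof (rule ringI)
  show "abelian_group (ring_on \<O>)"
  proof (rule abelian_groupI)
    show "\<exists>y\<in>carrier (ring_on \<O>). y \<oplus>\<^bsub>ring_on \<O>\<^esub> x = \<zero>\<^bsub>ring_on \<O>\<^esub>"
      if "x \<in> carrier (ring_on \<O>)" for x
      using that by (intro bexI[of _ "- x"]) (simp_all add: ring_on_simps integral_uminus)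
  qed (simp_all add: ring_on_simps integral_add integral_zero add_ac)
  show "monoid (ring_on \<O>)"
    by (rule monoidI) (auto simp: ring_on_simps integral_mult integral_one)
qed (auto simp: ring_on_simps algebra_simps)

text \<open>If \<open>\<O>\<close> were not local, its non-units would generate the unit ideal, whose powers are all
  trivial.\<close>

lemma max_ideal_add:
  assumes ram: "ramified v \<iota>" and x: "x \<in> max_ideal \<O>" and y: "y \<in> max_ideal \<O>"
  shows "x + y \<in> max_ideal \<O>"
proof (rule ccontr)
  assume "x + y \<notin> max_ideal \<O>"
  moreover have "x + y \<in> \<O>" using x y by (simp add: in_max_ideal_iff integral_add)
  ultimately have s: "x + y \<noteq> 0" "1 / (x + y) \<in> \<O>" by (auto simp: in_max_ideal_iff)
  \<comment> \<open>As 1 / (x + y) is integral, an integral r is the sum of r / (x + y) * x and r /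
    (x + y) * y, which carries r from one power to the next.\<close>
  have pow: "\<O> \<subseteq> max_ideal \<O> [^]\<^bsub>ideals_set (ring_on \<O>)\<^esub> (n::nat)" for n
  proof (induction n)
    case 0
    then show ?case by (simp add: nat_pow_def ideals_set_def ring_on_simps)
  next
    case (Suc n)
    show ?case
    proof
      fix r assume "r \<in> \<O>"
      then have "r * (1 / (x + y)) \<in> \<O>" using s by (intro integral_mult)
      then have c: "r / (x + y) \<in> max_ideal \<O> [^]\<^bsub>ideals_set (ring_on \<O>)\<^esub> n" using Suc by auto
      let ?P = "ideal_prod (ring_on \<O>) (max_ideal \<O> [^]\<^bsub>ideals_set (ring_on \<O>)\<^esub> n) (max_ideal \<O>)"
      have "r / (x + y) * x + r / (x + y) * y \<in> ?P"
        using ideal_prod.sum[OF ideal_prod.prod[OF c x, of "ring_on \<O>"]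
            ideal_prod.prod[OF c y, of "ring_on \<O>"]]
        by (simp add: ring_on_simps)
      moreover have "r / (x + y) * x + r / (x + y) * y = r"
        using s(1) unfolding distrib_left[symmetric] by simp
      ultimately show "r \<in> max_ideal \<O> [^]\<^bsub>ideals_set (ring_on \<O>)\<^esub> Suc n"
        by (simp add: nat_pow_def ideals_set_def)
    qed
  qed
  obtain p where p: "p \<noteq> 0" "v p = 1" using val_normalized by blast
  \<comment> \<open>The ideal generated by the uniformizer p, written as a divisibility condition.
    It contains the image of the maximal ideal of \<open>R\<close>, so ramification puts 1 into it
    and makes 1 / p integral.\<close>
  define I where "I = {z \<in> \<O>. z / \<iota> p \<in> \<O>}"
  have "ideal I (ring_on \<O>)"
  proof (rule idealI[OF ring_ring_of_integers])
    interpret ring "ring_on \<O>" by (rule ring_ring_of_integers)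
    have neg: "\<ominus>\<^bsub>ring_on \<O>\<^esub> z = - z" if "z \<in> \<O>" for z
      using that by (intro minus_equality) (auto simp: ring_on_simps integral_uminus)
    show "subgroup I (add_monoid (ring_on \<O>))"
    proof (rule add.subgroupI)
      show "I \<subseteq> carrier (ring_on \<O>)" by (auto simp: I_def ring_on_simps)
      show "I \<noteq> {}" using integral_zero by (auto simp: I_def)
      show "\<ominus>\<^bsub>ring_on \<O>\<^esub> z \<in> I" if "z \<in> I" for z
        using that neg[of z] integral_uminus[of z] integral_uminus[of "z / \<iota> p"]
        by (simp add: I_def)
      show "y \<oplus>\<^bsub>ring_on \<O>\<^esub> z \<in> I" if "y \<in> I" "z \<in> I" for y z
        using that by (simp add: I_def ring_on_simps integral_add add_divide_distrib)
    qed
    show "x \<otimes>\<^bsub>ring_on \<O>\<^esub> z \<in> I" "z \<otimes>\<^bsub>ring_on \<O>\<^esub> x \<in> I"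
      if "z \<in> I" "x \<in> carrier (ring_on \<O>)" for z x
      using that integral_mult[of x z] integral_mult[of x "z / \<iota> p"]
      by (simp_all add: I_def ring_on_simps mult.commute)
  qed
  moreover have "\<iota> ` max_ideal R \<subseteq> I"
  proof safe
    fix a assume a: "a \<in> max_ideal R"
    have "a / p \<in> R"
    proof (cases "a = 0")
      case False
      then have "1 / a \<notin> R" "a \<in> R" using a by (auto simp: in_max_ideal_iff)
      moreover have "v (1 / a) = - v a" using val_mult[of "1 / a" a] False val_one by simp
      moreover have "v (a / p) = v a - 1" using val_mult[of "a / p" p] False p by simp
      ultimately show ?thesis using False by (simp add: valuation_ring_iff val_ge_def)
    qed (simp add: valuation_ring_simps)
    then show "\<iota> a \<in> I"
      using a by (simp add: I_def integral_emb_iff in_max_ideal_iff flip: emb_divide)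
  qed
  ultimately have "genideal (ring_on \<O>) (\<iota> ` max_ideal R) \<subseteq> I"
    by (rule ring.genideal_minimal[OF ring_ring_of_integers])
  then have "\<O> \<subseteq> I" using ram pow unfolding ramified_def Let_def by blast
  then have "\<iota> (1 / p) \<in> \<O>" using integral_one by (auto simp: I_def emb_simps)
  moreover have "v (1 / p) = - 1" using val_mult[of "1 / p" p] p val_one by simp
  ultimately show False using p by (simp add: integral_emb_iff valuation_ring_iff val_ge_def)
qed

text \<open>If the trace \<open>t\<close> of \<open>z\<close> is not integral, then \<open>z / t\<close> and its conjugate are integral non-units
  with sum 1.\<close>

lemma norm_one_integral:
  assumes ram: "ramified v \<iota>" and z: "z * bar z = 1"
  shows "z \<in> \<O>"
proof -
  obtain t where t: "z + bar z = \<iota> t" using trace_in_base by blast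
  show ?thesis
  proof (cases "t \<in> R")
    case True
    then show ?thesis using integralI[OF t, of 1] z by (simp add: emb_one valuation_ring_simps)
  next
    case False
    then have "t \<noteq> 0" and vt: "v t < 0" by (auto simp: valuation_ring_iff val_ge_def)
    then have t0: "\<iota> t \<noteq> 0" by (simp add: emb_eq_0_iff)
    define x where "x = z / \<iota> t"
    have bx: "bar x = bar z / \<iota> t" by (simp add: x_def bar_divide bar_emb)
    have tr: "x + bar x = 1"
      using t t0 unfolding bx by (simp add: x_def flip: add_divide_distrib)
    have no: "x * bar x = \<iota> (1 / (t * t))"
      using z unfolding bx by (simp add: x_def emb_simps)
    have "v (1 / (t * t)) = - (v t + v t)"
      using val_mult[of "1 / (t * t)" "t * t"] val_mult[of t t] \<open>t \<noteq> 0\<close> val_one by simp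
    then have int: "x \<in> \<O>"
      using vt tr no integralI[of x 1 "1 / (t * t)"] \<open>t \<noteq> 0\<close>
      by (simp add: emb_one valuation_ring_simps) (simp add: valuation_ring_iff val_ge_def)
    \<comment> \<open>If 1 / w were integral, so would be its norm t^2, whose valuation is negative.
      This serves both x and \<open>bar x\<close>, which have the same norm.\<close>
    have no_unit: "\<not> (w \<noteq> 0 \<and> 1 / w \<in> \<O>)" if "w * bar w = \<iota> (1 / (t * t))" for w
    proof
      assume "w \<noteq> 0 \<and> 1 / w \<in> \<O>"
      then have "1 / w * bar (1 / w) \<in> \<O>" by (intro integral_mult integral_bar) auto
      then have "\<iota> (t * t) \<in> \<O>"
        using that by (simp add: bar_divide bar_1 emb_simps)
      then show False
        using vt \<open>t \<noteq> 0\<close> by (simp add: integral_emb_iff valuation_ring_iff val_ge_def val_mult)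
    qed
    have "x \<in> max_ideal \<O>" "bar x \<in> max_ideal \<O>"
      using int integral_bar no no_unit[of x] no_unit[of "bar x"]
      by (auto simp: in_max_ideal_iff bar_bar mult.commute)
    then have "1 \<in> max_ideal \<O>" using max_ideal_add[OF ram] tr by metis
    then show ?thesis using integral_one by (simp add: in_max_ideal_iff)
  qed
qed

text \<open>The quotient has norm 1. This lets denominators be exchanged for their conjugates in the
  integrality checks for symmetries.\<close>

lemma bar_ratio_integral:
  assumes "ramified v \<iota>" "x \<noteq> 0"
  shows "bar x / x \<in> \<O>"
proof -
  have "bar x \<noteq> 0" using assms(2) bar_eq_iff[of x 0] by (simp add: bar_0)
  then show ?thesis
    using assms by (intro norm_one_integral) (simp_all add: bar_divide bar_bar)
qed

text \<open>Without such a unit, every integral element would be congruent to 0 or 1 modulo the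
  non-units, and the residue field would be an explicit set of two cosets.\<close>

lemma exists_unit:
  assumes ram: "ramified v \<iota>" and card: "card (carrier (residue_field \<O>)) \<noteq> 2"
  shows "\<exists>\<epsilon>\<in>\<O>. \<epsilon> \<noteq> 0 \<and> 1 / \<epsilon> \<in> \<O> \<and> \<epsilon> \<noteq> 1 \<and> 1 / (\<epsilon> - 1) \<in> \<O>"
proof (rule ccontr)
  assume no: "\<not> ?thesis"
  let ?M = "max_ideal \<O>"
  have cases: "x \<in> ?M \<or> x - 1 \<in> ?M" if "x \<in> \<O>" for x
  proof -
    have "x - 1 \<in> \<O>" using integral_add[OF that integral_uminus[OF integral_one]] by simp
    then show ?thesis using no that by (auto simp: in_max_ideal_iff)
  qed
  have neg: "- x \<in> ?M" if "x \<in> ?M" for x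
    using that integral_uminus[of x] integral_uminus[of "- (1 / x)"] by (auto simp: in_max_ideal_iff)
  have coset: "?M +>\<^bsub>ring_on \<O>\<^esub> a = (\<lambda>m. m + a) ` ?M" for a
    by (auto simp: a_r_coset_def' ring_on_simps)
  \<comment> \<open>Equality of congruent cosets rests on the non-units being closed under addition,
    that is, on locality.\<close>
  have shift: "(\<lambda>m. m + a) ` ?M = (\<lambda>m. m + b) ` ?M" if "a - b \<in> ?M" for a b
  proof safe
    fix m assume m: "m \<in> ?M"
    show "m + a \<in> (\<lambda>m. m + b) ` ?M"
      using max_ideal_add[OF ram m that] by (intro image_eqI[of _ _ "m + (a - b)"]) auto
    show "m + b \<in> (\<lambda>m. m + a) ` ?M"
      using max_ideal_add[OF ram m neg[OF that]] by (intro image_eqI[of _ _ "m + - (a - b)"]) auto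
  qed
  have M: "0 \<in> ?M" "- 1 \<notin> ?M"
    using integral_zero integral_one integral_uminus by (auto simp: in_max_ideal_iff)
  have "carrier (residue_field \<O>) = (\<Union>a\<in>\<O>. {(\<lambda>m. m + a) ` ?M})"
    by (simp add: residue_field_def FactRing_def A_RCOSETS_def' coset ring_on_simps)
  also have "\<dots> = {(\<lambda>m. m + 0) ` ?M, (\<lambda>m. m + 1) ` ?M}"
  proof
    show "(\<Union>a\<in>\<O>. {(\<lambda>m. m + a) ` ?M}) \<subseteq> {(\<lambda>m. m + 0) ` ?M, (\<lambda>m. m + 1) ` ?M}"
    proof
      fix C assume "C \<in> (\<Union>a\<in>\<O>. {(\<lambda>m. m + a) ` ?M})"
      then obtain a where "a \<in> \<O>" "C = (\<lambda>m. m + a) ` ?M" by blast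
      then show "C \<in> {(\<lambda>m. m + 0) ` ?M, (\<lambda>m. m + 1) ` ?M}"
        using cases[of a] shift[of a 0] shift[of a 1] by auto
    qed
  qed (use integral_zero integral_one in blast)
  finally have "card (carrier (residue_field \<O>)) = card {(\<lambda>m. m + 0) ` ?M, (\<lambda>m. m + 1) ` ?M}"
    by simp
  moreover have "(\<lambda>m. m + 0) ` ?M \<noteq> (\<lambda>m. m + 1) ` ?M"
  proof
    assume "(\<lambda>m. m + 0) ` ?M = (\<lambda>m. m + 1) ` ?M"
    then have "0 \<in> (\<lambda>m. m + 1) ` ?M" using M(1) by (metis add_0 imageI)
    then obtain m where m: "m \<in> ?M" "m + 1 = 0" by auto
    then have "m = - 1" by (simp add: eq_neg_iff_add_eq_0)
    with m(1) show False using M(2) by simp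
  qed
  ultimately show False using card by simp
qed

end

section \<open>Symmetries and Eichler isometries of lattices\<close>

text \<open>Isolates the facts about the ring of integers on which the lattice argument rests, so
  that valuations no longer occur. The last assumption is the trace left by ramification.\<close>

locale integral_hermitian_space = hermitian_space scale bar h
  for scale :: "'e::field \<Rightarrow> 'v::ab_group_add \<Rightarrow> 'v" and bar h +
  fixes \<O> :: "'e set"
  assumes bar_add: "bar (x + y) = bar x + bar y"
    and bar_mult: "bar (x * y) = bar x * bar y"
    and bar_bar: "bar (bar x) = x"
    and one_int: "1 \<in> \<O>"
    and add_int: "x \<in> \<O> \<Longrightarrow> y \<in> \<O> \<Longrightarrow> x + y \<in> \<O>"
    and uminus_int: "x \<in> \<O> \<Longrightarrow> - x \<in> \<O>"
    and mult_int: "x \<in> \<O> \<Longrightarrow> y \<in> \<O> \<Longrightarrow> x * y \<in> \<O>"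
    and bar_int: "x \<in> \<O> \<Longrightarrow> bar x \<in> \<O>"
    and bar_ratio_int: "x \<noteq> 0 \<Longrightarrow> bar x / x \<in> \<O>"
begin

lemma bar_0 [simp]: "bar 0 = 0"
proof -
  have "bar 0 + bar 0 = bar 0 + 0"
    using bar_add[of 0 0] by simp
  then show ?thesis
    by (rule add_left_imp_eq)
qed

lemma bar_1 [simp]: "bar 1 = 1"
  using bar_mult[of 1 "bar 1"] by (simp add: bar_bar)

lemma bar_minus: "bar (- x) = - bar x"
  using bar_add[of x "- x"] by (simp add: eq_neg_iff_add_eq_0 add.commute)

lemma bar_diff: "bar (x - y) = bar x - bar y"
  using bar_add[of x "- y"] by (simp add: bar_minus)

lemma bar_eq_0_iff [simp]: "bar x = 0 \<longleftrightarrow> x = 0"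
  by (metis bar_0 bar_bar)

lemma bar_divide: "bar (x / y) = bar x / bar y"
proof (cases "y = 0")
  case False
  then have "bar (x / y) * bar y = bar x"
    by (simp flip: bar_mult)
  with False show ?thesis by (simp add: eq_divide_eq)
qed simp

lemmas bar_simps = bar_add bar_mult bar_minus bar_diff bar_divide bar_bar

lemma zero_int: "0 \<in> \<O>"
  using add_int[OF one_int uminus_int[OF one_int]] by simp

lemma diff_int: "x \<in> \<O> \<Longrightarrow> y \<in> \<O> \<Longrightarrow> x - y \<in> \<O>"
  using add_int[OF _ uminus_int] by fastforce

lemma form_add_left: "h (x + y) z = h x z + h y z"
  and form_scale_left: "h (scale c x) z = c * h x z"
  using form_linear[of z] by (simp_all add: Vector_Spaces.linear_iff)

lemma form_add_right: "h z (x + y) = h z x + h z y"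
  by (metis bar_add form_add_left form_hermitian)

lemma form_scale_right: "h z (scale c x) = bar c * h z x"
  by (metis bar_mult form_scale_left form_hermitian)

lemma form_minus_left: "h (- x) z = - h x z"
  using form_add_left[of x "- x" z] form_scale_left[of 0 0 z]
  by (simp add: eq_neg_iff_add_eq_0 add.commute)

lemma form_minus_right: "h z (- x) = - h z x"
  by (metis bar_minus form_minus_left form_hermitian)

lemma form_diff_left: "h (x - y) z = h x z - h y z"
  using form_add_left[of x "- y" z] by (simp add: form_minus_left)

lemma form_diff_right: "h z (x - y) = h z x - h z y"
  using form_add_right[of z x "- y"] by (simp add: form_minus_right)

lemmas form_simps = form_add_left form_add_right form_scale_left form_scale_right
  form_minus_left form_minus_right form_diff_left form_diff_right

lemma form_zero [simp]: "h 0 z = 0" "h z 0 = 0"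
  using form_scale_left[of 0 0 z] form_scale_right[of z 0 0] by simp_all

section \<open>Identities for isometries, symmetries and Eichler isometries\<close>

definition isometry :: "('v \<Rightarrow> 'v) \<Rightarrow> bool" where
  "isometry f \<longleftrightarrow> Vector_Spaces.linear scale scale f \<and> (\<forall>x y. h (f x) (f y) = h x y)"

lemma isometryD:
  assumes "isometry f"
  shows isometry_add: "f (x + y) = f x + f y"
    and isometry_scale: "f (scale c x) = scale c (f x)"
    and isometry_diff: "f (x - y) = f x - f y"
    and isometry_form: "h (f x) (f y) = h x y"
proof -
  have l: "Vector_Spaces.linear scale scale f" using assms by (simp add: isometry_def)
  then interpret f: Vector_Spaces.linear scale scale f .
  show "f (x + y) = f x + f y" "f (scale c x) = scale c (f x)" "f (x - y) = f x - f y"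
    by (simp_all add: f.add f.scale f.diff)
  show "h (f x) (f y) = h x y" using assms by (simp add: isometry_def)
qed

lemma isometryI:
  assumes "\<And>x y. f (x + y) = f x + f y" "\<And>c x. f (scale c x) = scale c (f x)"
    and "\<And>x y. h (f x) (f y) = h x y"
  shows "isometry f"
  using assms by (simp add: isometry_def Vector_Spaces.linear_iff vector_space_axioms)

lemma isometry_comp: "isometry f \<Longrightarrow> isometry g \<Longrightarrow> isometry (f \<circ> g)"
  by (rule isometryI) (simp_all add: isometryD)

text \<open>The mixed terms contribute 1 / \<sigma> and 1 / \<open>bar \<sigma>\<close>; the
  quadratic term \<open>h s s / (\<sigma> * bar \<sigma>)\<close> is their sum because
  \<open>h s s\<close> is the trace of \<sigma>.\<close>

lemma isometry_symmetry:
  assumes "\<sigma> \<noteq> 0" "h s s = trace bar \<sigma>"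
  shows "isometry (symmetry scale h s \<sigma>)"
proof (rule isometryI)
  fix x y
  have [simp]: "h s y = bar (h y s)" by (rule form_hermitian)
  have "h s s = \<sigma> + bar \<sigma>" using assms by (simp add: trace_def)
  then show "h (symmetry scale h s \<sigma> x) (symmetry scale h s \<sigma> y) = h x y"
    using assms(1)
    apply (simp add: symmetry_def form_simps bar_simps divide_inverse [symmetric])
    apply (simp add: field_simps)
    done
qed (simp_all add: symmetry_def form_simps algebra_simps)

text \<open>Provides inverses of symmetries that are again symmetries along the same vector;
  bijectivity and preservation of lattices are read off from this.\<close>

lemma symmetry_comp_symmetry_bar:
  assumes "\<sigma> \<noteq> 0" "h s s = trace bar \<sigma>"
  shows "symmetry scale h s \<sigma> \<circ> symmetry scale h s (bar \<sigma>) = id"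
proof
  fix x
  have "h x s / bar \<sigma> + (h x s - h x s * h s s / bar \<sigma>) / \<sigma> = 0"
    using assms by (simp add: trace_def field_simps)
  moreover have "(symmetry scale h s \<sigma> \<circ> symmetry scale h s (bar \<sigma>)) x =
      x - scale (h x s / bar \<sigma> + (h x s - h x s * h s s / bar \<sigma>) / \<sigma>) s"
    by (simp add: symmetry_def form_simps algebra_simps divide_inverse)
  ultimately show "(symmetry scale h s \<sigma> \<circ> symmetry scale h s (bar \<sigma>)) x = id x"
    by simp
qed

lemma trace_bar: "trace bar (bar \<sigma>) = trace bar \<sigma>"
  by (simp add: trace_def bar_bar add.commute)

text \<open>Conjugation in a form free of inverses: an isometry merely transports the vectors in the
  data.\<close>

lemma isometry_comp_symmetry:
  assumes "isometry f"
  shows "f \<circ> symmetry scale h s \<sigma> = symmetry scale h (f s) \<sigma> \<circ> f"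
  by (simp add: fun_eq_iff symmetry_def isometryD[OF assms])

lemma isometry_comp_eichler:
  assumes "isometry f"
  shows "f \<circ> eichler scale h u w y \<mu> = eichler scale h (f u) (f w) (f y) \<mu> \<circ> f"
  by (simp add: fun_eq_iff eichler_def isometryD[OF assms])

lemma isometry_eichler:
  assumes "h u w \<noteq> 0" "h u u = 0" "h y u = 0" "trace bar (\<mu> * h u w) = - h y y"
  shows "isometry (eichler scale h u w y \<mu>)"
proof (rule isometryI)
  fix x z
  have uw: "h w u = bar (h u w)" by (rule form_hermitian)
  have uy: "h u y = 0" using assms(3) form_hermitian[of u y] by simp
  have [simp]: "h u z = bar (h z u)" "h y z = bar (h z y)" by (rule form_hermitian)+
  have yy: "h y y = - (\<mu> * h u w + bar \<mu> * bar (h u w))"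
    using assms(4) by (simp add: trace_def bar_mult)
  show "h (eichler scale h u w y \<mu> x) (eichler scale h u w y \<mu> z) = h x z"
    using assms(1)
    by (simp add: eichler_def form_simps bar_simps uw uy assms(2,3) yy) (simp add: field_simps)
qed (simp_all add: eichler_def form_simps algebra_simps add_divide_distrib)

text \<open>A Heisenberg-type group law for fixed u and w: the vectors add, and the scalars add up
  to a correction by the form. With one vector zero it compares two Eichler isometries of the same
  vector.\<close>

lemma eichler_comp_eichler:
  assumes "h u w \<noteq> 0" "h u u = 0" "h y u = 0" "h z u = 0"
  shows "eichler scale h u w y \<mu> \<circ> eichler scale h u w z \<nu> =
    eichler scale h u w (y + z) (\<mu> + \<nu> - h z y / h u w)"
proof
  fix x
  have uw: "h w u = bar (h u w)" by (rule form_hermitian)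
  have uy: "h u y = 0" "h u z = 0"
    using assms(3,4) form_hermitian[of u y] form_hermitian[of u z] by simp_all
  have *: "\<nu> * h x u / h w u - h x z / h u w + (\<mu> * h x u / h w u -
      (h x y + h x u / h w u * h z y) / h u w) =
    (\<mu> + \<nu> - h z y / h u w) * h x u / h w u - h x (y + z) / h u w"
    using assms(1) by (simp add: uw form_simps field_simps)
  have "(eichler scale h u w y \<mu> \<circ> eichler scale h u w z \<nu>) x =
    x + scale (h x u / h w u) (y + z) + scale (\<nu> * h x u / h w u - h x z / h u w
      + (\<mu> * h x u / h w u - (h x y + h x u / h w u * h z y) / h u w)) u"
    unfolding eichler_def
    by (simp add: form_simps assms uy scale_left_distrib scale_right_distrib add_ac)
  then show "(eichler scale h u w y \<mu> \<circ> eichler scale h u w z \<nu>) x =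
      eichler scale h u w (y + z) (\<mu> + \<nu> - h z y / h u w) x"
    unfolding * by (simp add: eichler_def)
qed

lemma eichler_zero: "eichler scale h u w 0 \<delta> x = x + scale (\<delta> * h x u / h w u) u"
  by (simp add: eichler_def)

section \<open>Unitary groups and the subgroup generated by symmetries\<close>

lemma carrier_unitary_group: "carrier (unitary_group scale h) = {f. isometry f \<and> bij f}"
  by (auto simp: unitary_group_def isometry_def)

lemma isometry_id: "isometry id"
  by (rule isometryI) simp_all

lemma unitary_group_sel [simp]:
  "f \<otimes>\<^bsub>unitary_group scale h\<^esub> g = f \<circ> g" "\<one>\<^bsub>unitary_group scale h\<^esub> = id"
  by (simp_all add: unitary_group_def)

lemma group_unitary_group: "group (unitary_group scale h)"
proof (rule groupI)
  fix f assume f: "f \<in> carrier (unitary_group scale h)"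
  then have i: "isometry f" and b: "bij f"
    by (auto simp: carrier_unitary_group)
  have fi: "f (inv_into UNIV f x) = x" for x using b by (simp add: bij_is_surj surj_f_inv_f)
  have inj: "f x = f y \<Longrightarrow> x = y" for x y using b by (simp add: bij_is_inj inj_eq)
  have "isometry (inv_into UNIV f)"
  proof (rule isometryI)
    show "h (inv_into UNIV f x) (inv_into UNIV f y) = h x y" for x y
      using isometry_form[OF i, of "inv_into UNIV f x" "inv_into UNIV f y"] by (simp add: fi)
  qed (rule inj, simp add: isometryD[OF i] fi)+
  then show "\<exists>g\<in>carrier (unitary_group scale h). g \<otimes>\<^bsub>unitary_group scale h\<^esub> f =
      \<one>\<^bsub>unitary_group scale h\<^esub>"
    using b by (intro bexI[of _ "inv_into UNIV f"])
      (auto simp: carrier_unitary_group bij_imp_bij_inv bij_is_inj)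
qed (auto simp: carrier_unitary_group bij_comp isometry_id comp_assoc intro: isometry_comp)

lemma subgroup_lattice_isometries:
  "subgroup (lattice_isometries scale h L) (unitary_group scale h)"
proof -
  interpret group "unitary_group scale h" by (rule group_unitary_group)
  show ?thesis
  proof (rule subgroupI)
    fix f assume f: "f \<in> lattice_isometries scale h L"
    then have fc: "f \<in> carrier (unitary_group scale h)" and fL: "f ` L = L"
      by (auto simp: lattice_isometries_def)
    define g where "g = inv\<^bsub>unitary_group scale h\<^esub> f"
    have "g \<circ> f = id" using l_inv[OF fc] by (simp add: g_def)
    then have "g ` f ` L = L" by (simp add: image_comp)
    then show "inv\<^bsub>unitary_group scale h\<^esub> f \<in> lattice_isometries scale h L"
      using inv_closed[OF fc] fL by (simp add: lattice_isometries_def g_def)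
  next
    fix f g assume "f \<in> lattice_isometries scale h L" "g \<in> lattice_isometries scale h L"
    then show "f \<otimes>\<^bsub>unitary_group scale h\<^esub> g \<in> lattice_isometries scale h L"
      using image_comp[of f g L]
      by (simp add: lattice_isometries_def carrier_unitary_group isometry_comp bij_comp)
  qed (auto simp: lattice_isometries_def carrier_unitary_group isometry_id intro!: exI[of _ id])
qed

lemma group_lattice_unitary_group: "group (lattice_unitary_group scale h L)"
  unfolding lattice_unitary_group_def
  by (rule subgroup.subgroup_is_group[OF subgroup_lattice_isometries group_unitary_group])

lemma symmetry_subgroup_is_subgroup:
  "subgroup (symmetry_subgroup scale bar h L) (lattice_unitary_group scale h L)"
  unfolding symmetry_subgroup_def
  by (rule group.generate_is_subgroup[OF group_lattice_unitary_group])
     (simp add: lattice_unitary_group_def)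

lemma comp_symmetry_subgroup:
  "f \<in> symmetry_subgroup scale bar h L \<Longrightarrow> g \<in> symmetry_subgroup scale bar h L \<Longrightarrow>
    f \<circ> g \<in> symmetry_subgroup scale bar h L"
  using subgroup.m_closed[OF symmetry_subgroup_is_subgroup, of f L g]
  by (simp add: lattice_unitary_group_def unitary_group_def)

lemma id_symmetry_subgroup: "id \<in> symmetry_subgroup scale bar h L"
  using subgroup.one_closed[OF symmetry_subgroup_is_subgroup]
  by (simp add: lattice_unitary_group_def unitary_group_def)

section \<open>Integrality of symmetries and hyperbolic pairs\<close>

definition module_set :: "'v set \<Rightarrow> bool" where
  "module_set L \<longleftrightarrow> (\<forall>x\<in>L. \<forall>y\<in>L. x + y \<in> L) \<and> (\<forall>c\<in>\<O>. \<forall>x\<in>L. scale c x \<in> L)"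

lemma module_setD:
  assumes "module_set L"
  shows module_set_add: "x \<in> L \<Longrightarrow> y \<in> L \<Longrightarrow> x + y \<in> L"
    and module_set_scale: "c \<in> \<O> \<Longrightarrow> x \<in> L \<Longrightarrow> scale c x \<in> L"
    and module_set_diff: "x \<in> L \<Longrightarrow> y \<in> L \<Longrightarrow> x - y \<in> L"
proof -
  show 1: "x \<in> L \<Longrightarrow> y \<in> L \<Longrightarrow> x + y \<in> L" and 2: "c \<in> \<O> \<Longrightarrow> x \<in> L \<Longrightarrow> scale c x \<in> L"
    for x y c using assms by (auto simp: module_set_def)
  show "x \<in> L \<Longrightarrow> y \<in> L \<Longrightarrow> x - y \<in> L"
    using 1[of x "scale (- 1) y"] 2[of "- 1" y] uminus_int[OF one_int] by simp
qed

lemma module_set_lattice_span: "module_set (lattice_span \<O> scale B)"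
  unfolding module_set_def lattice_span_def
proof (intro conjI ballI; clarsimp)
  fix c d assume "\<forall>b\<in>B. c b \<in> \<O>" "\<forall>b\<in>B. d b \<in> \<O>"
  then show "\<exists>e. (\<Sum>b\<in>B. scale (c b) b) + (\<Sum>b\<in>B. scale (d b) b) = (\<Sum>b\<in>B. scale (e b) b) \<and>
      (\<forall>b\<in>B. e b \<in> \<O>)"
    by (intro exI[of _ "\<lambda>b. c b + d b"]) (simp add: scale_left_distrib sum.distrib add_int)
next
  fix a c assume "a \<in> \<O>" "\<forall>b\<in>B. c b \<in> \<O>"
  then show "\<exists>e. scale a (\<Sum>b\<in>B. scale (c b) b) = (\<Sum>b\<in>B. scale (e b) b) \<and> (\<forall>b\<in>B. e b \<in> \<O>)"
    by (intro exI[of _ "\<lambda>b. a * c b"]) (simp add: scale_sum_right mult_int)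
qed

text \<open>Integral coefficients make the symmetry map L into itself. Its inverse has the conjugate
  parameter and is integral too, so L is mapped onto itself.\<close>

lemma symmetry_in_symmetry_subgroup:
  assumes L: "module_set L" and s: "s \<in> L" and \<sigma>: "\<sigma> \<noteq> 0" "h s s = trace bar \<sigma>"
    and int: "\<And>x. x \<in> L \<Longrightarrow> h x s / \<sigma> \<in> \<O>"
  shows "symmetry scale h s \<sigma> \<in> symmetry_subgroup scale bar h L"
    and "symmetry scale h s (bar \<sigma>) \<in> symmetry_subgroup scale bar h L"
proof -
  have int': "h x s / bar \<sigma> \<in> \<O>" if "x \<in> L" for x
    using mult_int[OF int[OF that] bar_ratio_int[of "bar \<sigma>"]] \<sigma>(1) by (simp add: bar_bar)
  \<comment> \<open>The assumptions are symmetric in \<tau> and \<open>bar \<tau>\<close>, so this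
    yields both conclusions.\<close>
  have *: "symmetry scale h s \<tau> \<in> symmetry_subgroup scale bar h L"
    if \<tau>: "\<tau> \<noteq> 0" "h s s = trace bar \<tau>" "\<And>x. x \<in> L \<Longrightarrow> h x s / \<tau> \<in> \<O>"
      "\<And>x. x \<in> L \<Longrightarrow> h x s / bar \<tau> \<in> \<O>" for \<tau>
  proof -
    let ?S = "symmetry scale h s \<tau>" and ?T = "symmetry scale h s (bar \<tau>)"
    have ST: "?S \<circ> ?T = id" using symmetry_comp_symmetry_bar[OF \<tau>(1,2)] .
    have TS: "?T \<circ> ?S = id"
      using symmetry_comp_symmetry_bar[of "bar \<tau>" s] \<tau>(1,2) by (simp add: trace_bar bar_bar)
    have SL: "?S x \<in> L" "?T x \<in> L" if "x \<in> L" for x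
      unfolding symmetry_def divide_inverse[symmetric]
      using that \<tau>(3,4) s by (auto intro!: module_setD[OF L])
    have "?S ` L = L"
    proof
      show "L \<subseteq> ?S ` L"
      proof
        fix x assume "x \<in> L"
        then show "x \<in> ?S ` L"
          using SL(2)[of x] fun_cong[OF ST, of x] by (intro image_eqI[of _ _ "?T x"]) simp_all
      qed
    qed (use SL in auto)
    moreover have "bij ?S" using ST TS by (metis o_bij)
    moreover have "isometry ?S" using \<tau> by (intro isometry_symmetry)
    ultimately have "?S \<in> lattice_isometries scale h L"
      by (simp add: lattice_isometries_def unitary_group_def isometry_def)
    moreover have "?S \<in> symmetries scale bar h" using \<tau> by (auto simp: symmetries_def)
    ultimately show ?thesis
      unfolding symmetry_subgroup_def by (blast intro: generate.incl)
  qed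
  show "symmetry scale h s \<sigma> \<in> symmetry_subgroup scale bar h L"
    by (rule *[OF \<sigma> int int'])
  show "symmetry scale h s (bar \<sigma>) \<in> symmetry_subgroup scale bar h L"
    by (rule *) (use \<sigma> int int' in \<open>auto simp: trace_bar bar_bar\<close>)
qed

text \<open>Nondegeneracy enters here: if \<open>h u w\<close> vanished, u would be orthogonal to
  all of L. For x = c u + d w + q, \<open>h x u\<close> is d times the conjugate of
  \<open>h u w\<close>, so its quotient by \<open>h u w\<close> is integral by
  \<open>bar_ratio_int\<close>.\<close>

lemma hyperbolic_pair_splitsD:
  assumes split: "hyperbolic_pair_splits \<O> scale h L u w" and nd: "nondegenerate h L"
  shows "u \<in> L" "w \<in> L" "h u u = 0" "h w w = 0" "h u w \<noteq> 0"
    and "x \<in> L \<Longrightarrow> h x u / h u w \<in> \<O> \<and> h x w / h u w \<in> \<O>"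
    and "y \<in> orthogonal_complement h L (lattice_span \<O> scale {u, w}) \<Longrightarrow>
      y \<in> L \<and> h y u = 0 \<and> h y w = 0"
proof -
  define P where "P = lattice_span \<O> scale {u, w}"
  note s = split[unfolded hyperbolic_pair_splits_def Let_def]
  show uL: "u \<in> L" and "w \<in> L" and uu: "h u u = 0" and ww: "h w w = 0"
    using s by auto
  have "u \<noteq> w" and "independent {u, w}" using s by auto
  then have "u \<noteq> 0" by (metis dependent_zero insertI1)
  have P_iff: "x \<in> P \<longleftrightarrow> (\<exists>c d. c \<in> \<O> \<and> d \<in> \<O> \<and> x = scale c u + scale d w)" for x
  proof
    assume "x \<in> P"
    then obtain f where "x = (\<Sum>b\<in>{u, w}. scale (f b) b)" "\<forall>b\<in>{u, w}. f b \<in> \<O>"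
      unfolding P_def lattice_span_def by blast
    then show "\<exists>c d. c \<in> \<O> \<and> d \<in> \<O> \<and> x = scale c u + scale d w"
      using \<open>u \<noteq> w\<close> by (intro exI[of _ "f u"] exI[of _ "f w"]) simp
  next
    assume "\<exists>c d. c \<in> \<O> \<and> d \<in> \<O> \<and> x = scale c u + scale d w"
    then obtain c d where "c \<in> \<O>" "d \<in> \<O>" "x = scale c u + scale d w" by blast
    then show "x \<in> P"
      unfolding P_def lattice_span_def mem_Collect_eq using \<open>u \<noteq> w\<close>
      by (intro exI[of _ "\<lambda>b. if b = u then c else d"]) simp
  qed
  have "scale 1 u + scale 0 w \<in> P" "scale 0 u + scale 1 w \<in> P"
    unfolding P_iff using one_int zero_int by blast+
  then have uwP: "u \<in> P" "w \<in> P" by simp_all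
  have perp: "y \<in> L \<and> h y u = 0 \<and> h y w = 0" if "y \<in> orthogonal_complement h L P" for y
    using that uwP by (simp add: orthogonal_complement_def)
  then show "y \<in> orthogonal_complement h L (lattice_span \<O> scale {u, w}) \<Longrightarrow>
      y \<in> L \<and> h y u = 0 \<and> h y w = 0"
    by (simp add: P_def)
  have L: "L = {p + q | p q. p \<in> P \<and> q \<in> orthogonal_complement h L P}"
    unfolding P_def using s by (elim conjE)
  have dec: "\<exists>c d q. c \<in> \<O> \<and> d \<in> \<O> \<and> h q u = 0 \<and> h q w = 0 \<and> x = scale c u + scale d w + q"
    if "x \<in> L" for x
  proof -
    have "x \<in> {p + q | p q. p \<in> P \<and> q \<in> orthogonal_complement h L P}"
      using \<open>x \<in> L\<close> by (subst (asm) L)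
    then obtain p q where p: "p \<in> P" and q: "q \<in> orthogonal_complement h L P" and x: "x = p + q"
      by blast
    from p obtain c d where "c \<in> \<O>" "d \<in> \<O>" "p = scale c u + scale d w"
      unfolding P_iff by blast
    then show ?thesis using perp[OF q] x by blast
  qed
  have wu: "h w u = bar (h u w)" by (rule form_hermitian)
  show nz: "h u w \<noteq> 0"
  proof
    assume 0: "h u w = 0"
    have "h u z = 0" if z: "z \<in> L" for z
    proof -
      obtain c d q where "h q u = 0" "z = scale c u + scale d w + q"
        using dec[OF z] by auto
      then have "h z u = 0" by (simp add: form_simps uu wu 0)
      then show ?thesis using form_hermitian[of u z] by simp
    qed
    then show False using nd uL \<open>u \<noteq> 0\<close> by (auto simp: nondegenerate_def)
  qed
  show "h x u / h u w \<in> \<O> \<and> h x w / h u w \<in> \<O>" if x: "x \<in> L"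
  proof -
    obtain c d q where "c \<in> \<O>" "d \<in> \<O>" "h q u = 0" "h q w = 0" "x = scale c u + scale d w + q"
      using dec[OF x] by auto
    then show ?thesis
      using mult_int[OF \<open>d \<in> \<O>\<close> bar_ratio_int[OF nz]] nz
      by (simp add: form_simps uu ww wu)
  qed
qed

section \<open>Eichler isometries as products of symmetries\<close>

text \<open>Rests on the factorization \<open>E_eq\<close>: two symmetries make up T, two more are
  the inverses of their conjugates under \<open>E y' \<mu>'\<close>, and the remaining factor
  \<open>E 0 \<delta>\<close> is a symmetry along u or the identity.\<close>

lemma eichler_in_symmetry_subgroup:
  assumes L: "module_set L" and mem: "u \<in> L" "w \<in> L" "y \<in> L"
    and uu: "h u u = 0" and ww: "h w w = 0" and nz: "h u w \<noteq> 0"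
    and yu: "h y u = 0" and yw: "h y w = 0"
    and intu: "\<And>x. x \<in> L \<Longrightarrow> h x u / h u w \<in> \<O>"
    and intw: "\<And>x. x \<in> L \<Longrightarrow> h x w / h u w \<in> \<O>"
    and inty: "\<And>x. x \<in> L \<Longrightarrow> h x y / h u w \<in> \<O>"
    and \<mu>: "\<mu> \<in> \<O>" "trace bar (\<mu> * h u w) = - h y y"
    and \<epsilon>: "\<epsilon> \<in> \<O>" "\<epsilon> \<noteq> 0" "1 / \<epsilon> \<in> \<O>" "\<epsilon> \<noteq> 1" "1 / (\<epsilon> - 1) \<in> \<O>"
  shows "eichler scale h u w y \<mu> \<in> symmetry_subgroup scale bar h L"
proof -
  define a where "a = h u w"
  have a: "a \<noteq> 0" using nz by (simp add: a_def)
  have uw: "h u w = a" "h w u = bar a" using form_hermitian[of w u] by (simp_all add: a_def)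
  define \<eta> where "\<eta> = bar \<epsilon> - 1"
  have bar_\<eta>: "bar \<eta> = \<epsilon> - 1" by (simp add: \<eta>_def bar_simps)
  have \<eta>0: "\<eta> \<noteq> 0" "bar \<eta> \<noteq> 0" using \<epsilon>(4) bar_\<eta> bar_eq_0_iff[of \<eta>] by auto
  have \<eta>_int: "1 / bar \<eta> \<in> \<O>" "1 / \<eta> \<in> \<O>" "\<eta> \<in> \<O>"
    using \<epsilon>(5) bar_int[OF \<epsilon>(5)] diff_int[OF bar_int[OF \<epsilon>(1)] one_int]
    by (simp_all add: \<eta>_def bar_simps)
  \<comment> \<open>Conjugation by T will multiply y' by \<open>bar \<epsilon>\<close>, so the
    commutator has vector \<eta> y' = y. Dividing \<mu> by the norm of \<eta> keeps the trace
    condition valid for y'.\<close>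
  define y' where "y' = scale (1 / \<eta>) y"
  define \<mu>' where "\<mu>' = \<mu> / (\<eta> * bar \<eta>)"
  define Y where "Y = h y' y'"
  have y_y': "y = scale \<eta> y'" and \<mu>_\<mu>': "\<mu> = \<mu>' * (\<eta> * bar \<eta>)"
    using \<eta>0 by (simp_all add: y'_def \<mu>'_def)
  have barY: "bar Y = Y" unfolding Y_def by (rule form_hermitian[symmetric])
  have y'L: "y' \<in> L" using \<eta>_int mem by (simp add: y'_def module_setD[OF L])
  have y'u: "h y' u = 0" "h y' w = 0" "h u y' = 0" "h w y' = 0"
    using yu yw form_hermitian[of u y'] form_hermitian[of w y']
    by (simp_all add: y'_def form_simps)
  have inty': "h x y' / a \<in> \<O>" if "x \<in> L" for x
    using mult_int[OF \<eta>_int(1) inty[OF that]] by (simp add: y'_def form_simps a_def bar_simps)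
  have \<mu>'_int: "\<mu>' \<in> \<O>"
    using mult_int[OF \<mu>(1) mult_int[OF \<eta>_int(1,2)]] by (simp add: \<mu>'_def mult.commute)
  have tr: "\<mu>' * a + bar \<mu>' * bar a = - Y"
  proof -
    have "\<eta> * bar \<eta> * (\<mu>' * a + bar \<mu>' * bar a) = \<eta> * bar \<eta> * (- Y)"
      using \<mu>(2) by (simp add: trace_def y_y' \<mu>_\<mu>' form_simps bar_simps uw Y_def algebra_simps)
    then show ?thesis using \<eta>0 by (metis mult_cancel_left mult_eq_0_iff)
  qed
  define E where "E = eichler scale h u w"
  have E'_iso: "isometry (E y' \<mu>')"
    unfolding E_def using a tr
    by (intro isometry_eichler) (simp_all add: uw uu y'u trace_def bar_simps flip: Y_def)
  note E_comp = eichler_comp_eichler[of u w, folded E_def, unfolded uw, OF a uu]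

  \<comment> \<open>Here \<sigma> is \<open>h u s\<close> and \<sigma>' is \<open>h w s'\<close>, so
    S takes u to u - s and S' takes w to w - s'. The two signs cancel in T.\<close>
  define s \<sigma> where "s = u + scale \<epsilon> w" and "\<sigma> = a * bar \<epsilon>"
  define s' \<sigma>' where "s' = u + w" and "\<sigma>' = bar a"
  define S S' where "S = symmetry scale h s \<sigma>" and "S' = symmetry scale h s' \<sigma>'"
  have \<sigma>0: "\<sigma> \<noteq> 0" "\<sigma>' \<noteq> 0" using a \<epsilon> by (simp_all add: \<sigma>_def \<sigma>'_def)
  have \<sigma>s: "h s s = trace bar \<sigma>" "h s' s' = trace bar \<sigma>'"
    by (simp_all add: s_def s'_def \<sigma>_def \<sigma>'_def trace_def form_simps uu ww uw bar_simps mult_ac)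
  have iso: "isometry S" "isometry S'"
    unfolding S_def S'_def using \<sigma>0 \<sigma>s by (simp_all add: isometry_symmetry)
  define T where "T = S' \<circ> S"
  have T_iso: "isometry T" unfolding T_def by (intro isometry_comp iso)
  have "S u = scale (- \<epsilon>) w" "S' w = - u"
    using a \<epsilon> by (simp_all add: S_def S'_def symmetry_def s_def s'_def \<sigma>_def \<sigma>'_def form_simps uu ww uw
      divide_inverse[symmetric])
  then have Tu: "T u = scale \<epsilon> u"
    using isometry_scale[OF iso(2), of "- \<epsilon>" w] by (simp add: T_def)
  have Ty': "T y' = y'"
    by (simp add: T_def S_def S'_def symmetry_def s_def s'_def form_simps y'u)

  \<comment> \<open>The image of w need not be computed: an Eichler isometry depends on its second
    vector only through the pairing with the first, which T preserves. The factor \<epsilon> on u is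
    then absorbed into vector and scalar.\<close>
  have conj: "T \<circ> E y' \<mu>' = E (scale (bar \<epsilon>) y') (\<epsilon> * bar \<epsilon> * \<mu>') \<circ> T"
  proof -
    have Tw: "scale \<epsilon> u = T u" by (simp add: Tu)
    have "h (T w) (scale \<epsilon> u) = bar a" "h (scale \<epsilon> u) (T w) = a"
      unfolding Tw isometry_form[OF T_iso] by (simp_all add: uw)
    then have "eichler scale h (scale \<epsilon> u) (T w) y' \<mu>' = E (scale (bar \<epsilon>) y') (\<epsilon> * bar \<epsilon> * \<mu>')"
      by (simp only: eichler_def E_def fun_eq_iff uw)
         (simp add: form_simps bar_simps algebra_simps)
    then show ?thesis
      using isometry_comp_eichler[OF T_iso, of u w y' \<mu>'] by (simp add: E_def Tu Ty')
  qed

  \<comment> \<open>The solution of \<open>\<mu> + \<mu>' - h y' y / a = \<delta> + \<epsilon> * bar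
    \<epsilon> * \<mu>'\<close>, the comparison of scalars in the composition law.\<close>
  define \<delta> where "\<delta> = - \<mu>' * (\<eta> + bar \<eta>) - bar \<eta> * Y / a"
  have \<epsilon>_\<eta>: "\<epsilon> = bar \<eta> + 1" "bar \<epsilon> = \<eta> + 1" using bar_\<eta> by (simp_all add: \<eta>_def)
  have prod: "E y \<mu> \<circ> E y' \<mu>' = E 0 \<delta> \<circ> E (scale (bar \<epsilon>) y') (\<epsilon> * bar \<epsilon> * \<mu>')"
  proof -
    have "y + y' = scale (bar \<epsilon>) y'" by (simp add: y_y' \<epsilon>_\<eta>(2) scale_left_distrib)
    moreover have "\<epsilon> * bar \<epsilon> = (bar \<eta> + 1) * (\<eta> + 1)"
      unfolding \<epsilon>_\<eta>(2) by (subst \<epsilon>_\<eta>(1)) simp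
    then have "\<mu> + \<mu>' - h y' y / a = \<delta> + \<epsilon> * bar \<epsilon> * \<mu>'"
      by (simp add: \<delta>_def y_y' \<mu>_\<mu>' form_simps Y_def[symmetric] algebra_simps)
    ultimately show ?thesis
      using E_comp[of y y' \<mu> \<mu>'] E_comp[of 0 "scale (bar \<epsilon>) y'" \<delta> "\<epsilon> * bar \<epsilon> * \<mu>'"]
      by (simp add: form_simps yu y'u)
  qed
  \<comment> \<open>A right inverse, used to cancel \<open>E y' \<mu>'\<close> on the right; its
    scalar is forced by the composition law.\<close>
  have surj: "E y' \<mu>' \<circ> E (- y') (- \<mu>' - Y / a) = id"
    by (subst E_comp) (auto simp: y'u form_simps Y_def E_def eichler_zero)

  define w1 where "w1 = w + y' + scale \<mu>' u"
  define S1 S1' where "S1 = symmetry scale h (E y' \<mu>' s) \<sigma>"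
    and "S1' = symmetry scale h (E y' \<mu>' s') \<sigma>'"
  have Euw: "E y' \<mu>' u = u" "E y' \<mu>' w = w1"
    using a by (simp_all add: E_def eichler_def uu uw y'u w1_def)
  have Es: "E y' \<mu>' s = u + scale \<epsilon> w1" "E y' \<mu>' s' = u + scale 1 w1"
    by (simp_all add: s_def s'_def isometryD[OF E'_iso] Euw)
  \<comment> \<open>The commutator relation: \<open>E y' \<mu>'\<close> moves past the conjugated
    symmetries, leaving T on the right; then \<open>prod\<close> and \<open>conj\<close> bring T
    back to the left of it.\<close>
  have "E y \<mu> \<circ> (S1' \<circ> S1) \<circ> E y' \<mu>' = E 0 \<delta> \<circ> T \<circ> E y' \<mu>'"
  proof -
    have "S1 \<circ> E y' \<mu>' = E y' \<mu>' \<circ> S" "S1' \<circ> E y' \<mu>' = E y' \<mu>' \<circ> S'"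
      by (simp_all only: S1_def S1'_def S_def S'_def isometry_comp_symmetry[OF E'_iso])
    then have "E y \<mu> \<circ> (S1' \<circ> S1) \<circ> E y' \<mu>' = E y \<mu> \<circ> E y' \<mu>' \<circ> T"
      by (simp add: fun_eq_iff T_def)
    also have "\<dots> = E 0 \<delta> \<circ> T \<circ> E y' \<mu>'"
      unfolding prod comp_assoc conj ..
    finally show ?thesis .
  qed
  then have "E y \<mu> \<circ> (S1' \<circ> S1) \<circ> (E y' \<mu>' \<circ> E (- y') (- \<mu>' - Y / a)) =
      E 0 \<delta> \<circ> T \<circ> (E y' \<mu>' \<circ> E (- y') (- \<mu>' - Y / a))"
    by (simp only: comp_assoc[symmetric])
  then have *: "E y \<mu> \<circ> (S1' \<circ> S1) = E 0 \<delta> \<circ> T"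
    by (simp only: surj comp_id)
  have \<sigma>1: "h (E y' \<mu>' s) (E y' \<mu>' s) = trace bar \<sigma>"
      "h (E y' \<mu>' s') (E y' \<mu>' s') = trace bar \<sigma>'"
    by (simp_all add: isometry_form[OF E'_iso] \<sigma>s)
  define R R' where "R = symmetry scale h (E y' \<mu>' s) (bar \<sigma>)"
    and "R' = symmetry scale h (E y' \<mu>' s') (bar \<sigma>')"
  have "S1 \<circ> R = id" "S1' \<circ> R' = id"
    unfolding S1_def S1'_def R_def R'_def
    by (simp_all add: symmetry_comp_symmetry_bar \<sigma>0 \<sigma>1)
  then have "E y \<mu> = E y \<mu> \<circ> (S1' \<circ> S1) \<circ> (R \<circ> R')"
    by (simp add: fun_eq_iff)
  then have E_eq: "E y \<mu> = E 0 \<delta> \<circ> (S' \<circ> S) \<circ> (R \<circ> R')"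
    unfolding * T_def .

  have ratio: "a / bar a \<in> \<O>" using bar_ratio_int[of "bar a"] a by (simp add: bar_bar)
  \<comment> \<open>Both parameters differ from a by integral units, so all four integrality checks
    reduce to division by a.\<close>
  have \<sigma>_int: "c / \<sigma> \<in> \<O>" "c / \<sigma>' \<in> \<O>" if "c / a \<in> \<O>" for c
    using mult_int[OF that bar_int[OF \<epsilon>(3)]] mult_int[OF that ratio] a
    by (simp_all add: \<sigma>_def \<sigma>'_def bar_simps)
  have mem1: "w1 \<in> L" using mem y'L \<mu>'_int by (simp add: w1_def module_setD[OF L])
  have int1: "h x (u + scale c z) / a \<in> \<O>" if "x \<in> L" "c \<in> \<O>" "h x z / a \<in> \<O>" for x c z
    using add_int[OF intu[OF that(1)] mult_int[OF bar_int[OF that(2)] that(3)]]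
    by (simp add: form_simps uw add_divide_distrib)
  have intw1: "h x w1 / a \<in> \<O>" if "x \<in> L" for x
    using add_int[OF add_int[OF intw[OF that] inty'[OF that, folded uw]]
        mult_int[OF bar_int[OF \<mu>'_int] intu[OF that]]]
    by (simp add: w1_def form_simps uw add_divide_distrib)
  have "E 0 \<delta> \<in> symmetry_subgroup scale bar h L"
  \<comment> \<open>The symmetry below has parameter \<open>- bar a / \<delta>\<close>, so \<delta>
    = 0 is split off as the identity.\<close>
  proof (cases "\<delta> = 0")
    case True
    then have "E 0 \<delta> = id" by (simp add: fun_eq_iff E_def eichler_zero)
    then show ?thesis by (simp add: id_symmetry_subgroup)
  next
    case False
    have \<delta>_int: "\<delta> \<in> \<O>"
      using diff_int[OF mult_int[OF uminus_int[OF \<mu>'_int] add_int[OF \<eta>_int(3) bar_int[OF \<eta>_int(3)]]]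
          mult_int[OF bar_int[OF \<eta>_int(3)] inty'[OF y'L]]]
      by (simp add: \<delta>_def Y_def)
    have \<delta>a: "\<delta> * a = - (\<mu>' * a) * (\<eta> + bar \<eta>) - bar \<eta> * Y"
      using a by (simp add: \<delta>_def algebra_simps)
    then have "bar (\<delta> * a) = bar (- (\<mu>' * a) * (\<eta> + bar \<eta>) - bar \<eta> * Y)"
      by (rule arg_cong)
    then have bar_\<delta>a: "bar \<delta> * bar a = - (bar \<mu>' * bar a) * (\<eta> + bar \<eta>) - \<eta> * Y"
      by (simp add: bar_simps barY add.commute)
    have Y: "Y = - (\<mu>' * a + bar \<mu>' * bar a)" using tr by simp
    \<comment> \<open>The trace of \<open>\<delta> * a\<close> vanishes, which is exactly what a
      symmetry along the isotropic vector u requires of its parameter.\<close>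
    have \<delta>tr: "\<delta> * a = - (bar \<delta> * bar a)"
      unfolding \<delta>a bar_\<delta>a Y by (simp add: algebra_simps)
    have "E 0 \<delta> = symmetry scale h u (- bar a / \<delta>)"
      using a False by (simp add: fun_eq_iff E_def eichler_zero symmetry_def uw mult.commute)
    moreover have "symmetry scale h u (- bar a / \<delta>) \<in> symmetry_subgroup scale bar h L"
    proof (rule symmetry_in_symmetry_subgroup(1)[OF L mem(1)])
      show "h u u = trace bar (- bar a / \<delta>)"
        using False \<delta>tr by (simp add: uu trace_def bar_simps field_simps)
      show "h x u / (- bar a / \<delta>) \<in> \<O>" if "x \<in> L" for x
        using mult_int[OF mult_int[OF uminus_int[OF \<delta>_int] intu[OF that]] ratio] a
        by (simp add: uw mult.commute)
    qed (use a False in simp)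
    ultimately show ?thesis by simp
  qed
  moreover have "S \<in> symmetry_subgroup scale bar h L"
    unfolding S_def
  proof (rule symmetry_in_symmetry_subgroup(1)[OF L _ \<sigma>0(1) \<sigma>s(1)])
    show "s \<in> L" using mem \<epsilon>(1) by (simp add: s_def module_setD[OF L])
    show "h x s / \<sigma> \<in> \<O>" if "x \<in> L" for x
      using int1[OF that \<epsilon>(1) intw[OF that, unfolded uw]] by (simp only: s_def \<sigma>_int)
  qed
  moreover have "S' \<in> symmetry_subgroup scale bar h L"
    unfolding S'_def
  proof (rule symmetry_in_symmetry_subgroup(1)[OF L _ \<sigma>0(2) \<sigma>s(2)])
    show "s' \<in> L" using mem by (simp add: s'_def module_setD[OF L])
    show "h x s' / \<sigma>' \<in> \<O>" if "x \<in> L" for x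
      using int1[OF that one_int intw[OF that, unfolded uw]] by (simp add: s'_def \<sigma>_int)
  qed
  moreover have "R \<in> symmetry_subgroup scale bar h L"
    unfolding R_def
  proof (rule symmetry_in_symmetry_subgroup(2)[OF L _ \<sigma>0(1) \<sigma>1(1)])
    show "E y' \<mu>' s \<in> L" using mem mem1 \<epsilon>(1) by (simp add: Es module_setD[OF L])
    show "h x (E y' \<mu>' s) / \<sigma> \<in> \<O>" if "x \<in> L" for x
      using int1[OF that \<epsilon>(1) intw1[OF that]] by (simp only: Es \<sigma>_int)
  qed
  moreover have "R' \<in> symmetry_subgroup scale bar h L"
    unfolding R'_def
  proof (rule symmetry_in_symmetry_subgroup(2)[OF L _ \<sigma>0(2) \<sigma>1(2)])
    show "E y' \<mu>' s' \<in> L" using mem mem1 by (simp add: Es module_setD[OF L])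
    show "h x (E y' \<mu>' s') / \<sigma>' \<in> \<O>" if "x \<in> L" for x
      using int1[OF that one_int intw1[OF that]] by (simp only: Es \<sigma>_int)
  qed
  ultimately have "E 0 \<delta> \<circ> (S' \<circ> S) \<circ> (R \<circ> R') \<in> symmetry_subgroup scale bar h L"
    by (simp only: comp_symmetry_subgroup)
  then have "E y \<mu> \<in> symmetry_subgroup scale bar h L"
    by (subst E_eq)
  then show ?thesis
    by (simp only: E_def)
qed

lemma eichler_symmetry_subgroup_eq:
  assumes L: "hermitian_lattice \<O> scale L" and nd: "nondegenerate h L"
    and \<epsilon>: "\<epsilon> \<in> \<O>" "\<epsilon> \<noteq> 0" "1 / \<epsilon> \<in> \<O>" "\<epsilon> \<noteq> 1" "1 / (\<epsilon> - 1) \<in> \<O>"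
  shows "eichler_symmetry_subgroup \<O> scale bar h L = symmetry_subgroup scale bar h L"
proof
  have M: "module_set L"
    using L module_set_lattice_span by (auto simp: hermitian_lattice_def)
  have "eichler_isometries \<O> scale bar h L \<subseteq> symmetry_subgroup scale bar h L"
  proof
    fix f assume "f \<in> eichler_isometries \<O> scale bar h L"
    then obtain u w y \<mu> where f: "f = eichler scale h u w y \<mu>"
      and split: "hyperbolic_pair_splits \<O> scale h L u w"
      and y: "y \<in> orthogonal_complement h L (lattice_span \<O> scale {u, w})"
      and inty: "\<And>x. x \<in> L \<Longrightarrow> h x y \<in> {h u w * c | c. c \<in> \<O>}"
      and \<mu>: "\<mu> \<in> \<O>" "trace bar (\<mu> * h u w) = - h y y"
      unfolding eichler_isometries_def by blast
    note uw = hyperbolic_pair_splitsD[OF split nd]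
    show "f \<in> symmetry_subgroup scale bar h L"
      unfolding f
    proof (rule eichler_in_symmetry_subgroup[OF M uw(1,2) _ uw(3-5) _ _ _ _ _ \<mu> \<epsilon>])
      show "h x y / h u w \<in> \<O>" if "x \<in> L" for x
        using inty[OF that] uw(5) by auto
    qed (use uw(6) uw(7)[OF y] in simp_all)
  qed
  then show "eichler_symmetry_subgroup \<O> scale bar h L \<subseteq> symmetry_subgroup scale bar h L"
    unfolding eichler_symmetry_subgroup_def
    by (intro group.generate_subgroup_incl[OF group_lattice_unitary_group _
        symmetry_subgroup_is_subgroup]) simp
  show "symmetry_subgroup scale bar h L \<subseteq> eichler_symmetry_subgroup \<O> scale bar h L"
    unfolding eichler_symmetry_subgroup_def by (auto intro: generate.incl)
qed

end

theorem theoremA8: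
  fixes v :: "'k::field_char_0 \<Rightarrow> int"
    and \<iota> :: "'k \<Rightarrow> 'e::field"
    and bar :: "'e \<Rightarrow> 'e"
    and scale :: "'e \<Rightarrow> 'v::ab_group_add \<Rightarrow> 'v"
    and h :: "'v \<Rightarrow> 'v \<Rightarrow> 'e"
    and L :: "'v set"
  assumes "nonarch_local_field v"
    and "dyadic v"
    and "quadratic_extension \<iota> bar"
    and "ramified v \<iota>"
    and "card (carrier (residue_field (ring_of_integers v \<iota>))) \<noteq> 2"
    and "hermitian_space scale bar h"
    and "hermitian_lattice (ring_of_integers v \<iota>) scale L"
    and "nondegenerate h L"
  shows "eichler_symmetry_subgroup (ring_of_integers v \<iota>) scale bar h L =
         symmetry_subgroup scale bar h L"
proof -
  interpret K: local_quadratic_extension v \<iota> bar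
    using assms(1,3) by (rule local_quadratic_extension.intro)
  \<comment> \<open>Ramification is used here through \<open>bar_ratio_integral\<close>, and once
    more below through \<open>exists_unit\<close>.\<close>
  interpret H: integral_hermitian_space scale bar h "ring_of_integers v \<iota>"
    by (intro integral_hermitian_space.intro integral_hermitian_space_axioms.intro assms(6)
        K.bar_add K.bar_mult K.bar_bar K.integral_one K.integral_add K.integral_uminus
        K.integral_mult K.integral_bar K.bar_ratio_integral[OF assms(4)])
  show ?thesis
    using K.exists_unit[OF assms(4,5)] H.eichler_symmetry_subgroup_eq[OF assms(7,8)] by blast
qed

end
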